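(* Let $d\ge2$, let $\theta$ be a real antisymmetric $d\times d$ matrix, let $s=\frac d2$, $\alpha\in(0,1]$ and $0\ne u_0\in L_2(\mathbb{T}^d_\theta)$. Let $u$ be the mild solution of the Cauchy problem $$\partial_t^\alpha(u(t)-u_0)+(1-\Delta_\theta)^{\frac s2}u(t)=0,\ t>0,\qquad u(0)=u_0.$$ Then there is a constant $c>0$, independent of $t$, such that $$\|u(t)\|_{L_2(\mathbb{T}^d_\theta)}\le c\,t^{-\alpha},\quad t>0.$$
   Context: $\mathcal{A}_\theta$ is the (universal) $C^*$-algebra generated by unitaries $U_1,\dots,U_d$ with $U_kU_j=e^{2\pi i\theta_{kj}}U_jU_k$; for $n\in\mathbb{Z}^d$, $e_n^\theta=U_1^{n_1}\cdots U_d^{n_d}$; $\tau_\theta$ is the faithful tracial state with $\tau_\theta(\sum_n\alpha_ne_n^\theta)=\alpha_{\mathbf 0}$ on finite sums. $\mathbb{T}^d_\theta$ is the weak-$*$ closure of $\mathcal{A}_\theta$ in the GNS representation of $\tau_\theta$, and $\tau_\theta$ extends to it as a normal faithful tracial state. $L_2(\mathbb{T}^d_\theta)$ is the associated noncommutative $L_2$-space, $\|x\|_{L_2}=\tau_\theta(|x|^2)^{1/2}$; $\{e_n^\theta\}_{n\in\mathbb{Z}^d}$ is an orthonormal basis of it, and $\widehat x(n)=\tau_\theta(x(e_n^\theta)^* )$. $(1-\Delta_\theta)^{s/2}e_n^\theta=(1+|n|^2)^{s/2}e_n^\theta$, with $|n|$ Euclidean. For $0<\alpha<1$, $\partial_t^\alpha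 f(t)=\frac{d}{dt}\frac1{\Gamma(1-\alpha)}\int_0^t(t-r)^{-\alpha}f(r)\,dr$; for $\alpha=1$ it is the ordinary derivative. $E_\alpha(z)=\sum_{k\ge0}\frac{z^k}{\Gamma(\alpha k+1)}$ is the Mittag-Leffler function. The mild solution is by definition $$u(t)=\sum_{n\in\mathbb{Z}^d}E_\alpha\big(-t^\alpha(1+|n|^2)^{\frac s2}\big)\widehat{u}_0(n)e_n^\theta,\quad t>0.$$ *)

theory Defs
  imports "HOL-Analysis.Analysis"
begin

section \<open>Complex Hilbert spaces and C*-algebras\<close>

class complex_space = real_vector +
  fixes scaleC :: "complex \<Rightarrow> 'a \<Rightarrow> 'a"  (infixr \<open>*\<^sub>C\<close> 75)
  assumes scaleC_add_right: "c *\<^sub>C (x + y) = c *\<^sub>C x + c *\<^sub>C y"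
    and scaleC_add_left: "(b + c) *\<^sub>C x = b *\<^sub>C x + c *\<^sub>C x"
    and scaleC_scaleC: "b *\<^sub>C (c *\<^sub>C x) = (b * c) *\<^sub>C x"
    and scaleR_scaleC: "r *\<^sub>R x = complex_of_real r *\<^sub>C x"

text \<open>The inner product is linear in the first argument. The remaining inner product axioms
  (definiteness, and the norm being the induced one) are inherited from \<^class>\<open>real_inner\<close>
  through \<open>inner_eq_Re_cinner\<close>.\<close>

class complex_hilbert = complex_space + real_inner + complete_space +
  fixes cinner :: "'a \<Rightarrow> 'a \<Rightarrow> complex"
  assumes cinner_commute: "cinner x y = cnj (cinner y x)"
    and cinner_add_left: "cinner (x + y) z = cinner x z + cinner y z"
    and cinner_scaleC_left: "cinner (c *\<^sub>C x) y = c * cinner x y"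
    and inner_eq_Re_cinner: "x \<bullet> y = Re (cinner x y)"

class cstar_algebra = complex_space + real_normed_algebra_1 + complete_space +
  fixes star :: "'a \<Rightarrow> 'a"
  assumes norm_scaleC: "norm (c *\<^sub>C x) = cmod c * norm x"
    and mult_scaleC_left: "(c *\<^sub>C x) * y = c *\<^sub>C (x * y)"
    and mult_scaleC_right: "x * (c *\<^sub>C y) = c *\<^sub>C (x * y)"
    and star_star: "star (star x) = x"
    and star_add: "star (x + y) = star x + star y"
    and star_scaleC: "star (c *\<^sub>C x) = cnj c *\<^sub>C star x"
    and star_mult: "star (x * y) = star y * star x"
    and cstar_identity: "norm (star x * x) = (norm x)\<^sup>2"


section \<open>The universal algebra and its canonical trace\<close>

definition unitary :: "'a::cstar_algebra \<Rightarrow> bool" where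
  "unitary u \<longleftrightarrow> star u * u = 1 \<and> u * star u = 1"

definition star_subalgebra :: "'a::cstar_algebra set \<Rightarrow> bool" where
  "star_subalgebra S \<longleftrightarrow> 1 \<in> S \<and> (\<forall>x\<in>S. \<forall>y\<in>S. x + y \<in> S \<and> x * y \<in> S) \<and>
     (\<forall>x\<in>S. star x \<in> S \<and> (\<forall>c. c *\<^sub>C x \<in> S))"

definition star_hom :: "('a::cstar_algebra \<Rightarrow> 'b::cstar_algebra) \<Rightarrow> bool" where
  "star_hom \<phi> \<longleftrightarrow> \<phi> 1 = 1 \<and> (\<forall>x y. \<phi> (x + y) = \<phi> x + \<phi> y \<and> \<phi> (x * y) = \<phi> x * \<phi> y) \<and>
     (\<forall>x. \<phi> (star x) = star (\<phi> x) \<and> (\<forall>c. \<phi> (c *\<^sub>C x) = c *\<^sub>C \<phi> x))"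

definition torus_relations ::
    "real ^ ('d::{finite,linorder}) ^ ('d::{finite,linorder}) \<Rightarrow> ('d \<Rightarrow> 'a::cstar_algebra) \<Rightarrow> bool" where
  "torus_relations \<theta> U \<longleftrightarrow> (\<forall>k. unitary (U k)) \<and>
     (\<forall>k j. U k * U j = exp (2 * of_real pi * \<i> * of_real (\<theta> $ k $ j)) *\<^sub>C (U j * U k))"

text \<open>The type \<open>'a\<close>, with generators \<open>U\<close>, is the universal C*-algebra of the relations: it is
  generated by the \<open>U k\<close> as a C*-algebra, and any solution \<open>V\<close> of the relations in a C*-algebra
  \<open>'b\<close> is the image of \<open>U\<close> under a unital *-homomorphism. Types cannot be quantified inside a
  formula, so the target \<open>'b\<close> is a parameter, over which theorems are implicitly universal.\<close>

definition universal_torus_algebra ::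
    "'b::cstar_algebra itself \<Rightarrow> real ^ ('d::{finite,linorder}) ^ ('d::{finite,linorder}) \<Rightarrow>
     ('d \<Rightarrow> 'a::cstar_algebra) \<Rightarrow> bool"
  where
  "universal_torus_algebra _ \<theta> U \<longleftrightarrow> torus_relations \<theta> U \<and>
     (\<forall>S. closed S \<and> star_subalgebra S \<and> range U \<subseteq> S \<longrightarrow> S = UNIV) \<and>
     (\<forall>V :: 'd \<Rightarrow> 'b. torus_relations \<theta> V \<longrightarrow> (\<exists>\<phi>. star_hom \<phi> \<and> (\<forall>k. \<phi> (U k) = V k)))"

definition unitary_power :: "'a::cstar_algebra \<Rightarrow> int \<Rightarrow> 'a" where
  "unitary_power u m = (if m \<ge> 0 then u ^ nat m else star u ^ nat (- m))"

text \<open>The monomial $U_1^{n_1} \cdots U_d^{n_d}$, the factors being taken in the order of the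
  index type.\<close>

definition monomial :: "('d::{finite,linorder} \<Rightarrow> 'a::cstar_algebra) \<Rightarrow> int ^ ('d::{finite,linorder}) \<Rightarrow> 'a" where
  "monomial U n = prod_list (map (\<lambda>k. unitary_power (U k) (n $ k)) (sorted_list_of_set UNIV))"

definition faithful_tracial_state :: "('a::cstar_algebra \<Rightarrow> complex) \<Rightarrow> bool" where
  "faithful_tracial_state \<tau> \<longleftrightarrow>
     (\<forall>x y. \<tau> (x + y) = \<tau> x + \<tau> y) \<and> (\<forall>c x. \<tau> (c *\<^sub>C x) = c * \<tau> x) \<and>
     (\<forall>x. \<tau> (star x * x) \<in> \<real>\<^sub>\<ge>\<^sub>0) \<and> \<tau> 1 = 1 \<and>
     (\<forall>x y. \<tau> (x * y) = \<tau> (y * x)) \<and>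
     (\<forall>x. \<tau> (star x * x) = 0 \<longrightarrow> x = 0)"

definition canonical_trace ::
    "('d::{finite,linorder} \<Rightarrow> 'a::cstar_algebra) \<Rightarrow> ('a \<Rightarrow> complex) \<Rightarrow> bool" where
  "canonical_trace U \<tau> \<longleftrightarrow> faithful_tracial_state \<tau> \<and>
     (\<forall>F (a :: int ^ ('d::{finite,linorder}) \<Rightarrow> complex). finite F \<longrightarrow>
        \<tau> (\<Sum>n\<in>F. a n *\<^sub>C monomial U n) = (if 0 \<in> F then a 0 else 0))"


section \<open>The von Neumann algebra of the noncommutative torus\<close>

text \<open>The type \<open>'h \<Rightarrow>\<^sub>L 'h\<close> consists of the bounded \<^emph>\<open>real\<close>-linear operators.\<close>

definition complex_operators :: "('h::complex_hilbert \<Rightarrow>\<^sub>L 'h) set" where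
  "complex_operators = {x. \<forall>c \<xi>. blinfun_apply x (c *\<^sub>C \<xi>) = c *\<^sub>C blinfun_apply x \<xi>}"

definition op_scaleC :: "complex \<Rightarrow> ('h::complex_hilbert \<Rightarrow>\<^sub>L 'h) \<Rightarrow> 'h \<Rightarrow>\<^sub>L 'h" where
  "op_scaleC c x = Blinfun (\<lambda>\<xi>. c *\<^sub>C blinfun_apply x \<xi>)"

definition op_adjoint :: "('h::complex_hilbert \<Rightarrow>\<^sub>L 'h) \<Rightarrow> 'h \<Rightarrow>\<^sub>L 'h" where
  "op_adjoint x = (THE y. \<forall>\<xi> \<eta>. cinner (blinfun_apply x \<xi>) \<eta> = cinner \<xi> (blinfun_apply y \<eta>))"

definition star_representation ::
    "('a::cstar_algebra \<Rightarrow> ('h::complex_hilbert \<Rightarrow>\<^sub>L 'h)) \<Rightarrow> bool" where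
  "star_representation \<pi> \<longleftrightarrow> range \<pi> \<subseteq> complex_operators \<and> \<pi> 1 = id_blinfun \<and>
     (\<forall>a b. \<pi> (a + b) = \<pi> a + \<pi> b \<and> \<pi> (a * b) = \<pi> a o\<^sub>L \<pi> b) \<and>
     (\<forall>c a. \<pi> (c *\<^sub>C a) = op_scaleC c (\<pi> a)) \<and> (\<forall>a. \<pi> (star a) = op_adjoint (\<pi> a))"

definition gns_representation ::
    "('a::cstar_algebra \<Rightarrow> complex) \<Rightarrow> ('a \<Rightarrow> ('h::complex_hilbert \<Rightarrow>\<^sub>L 'h)) \<Rightarrow> 'h \<Rightarrow> bool" where
  "gns_representation \<tau> \<pi> \<Omega> \<longleftrightarrow> star_representation \<pi> \<and>
     closure (range (\<lambda>a. \<pi> a \<Omega>)) = UNIV \<and> (\<forall>a. \<tau> a = cinner (\<pi> a \<Omega>) \<Omega>)"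

text \<open>The trace class operators, as the predual of the algebra of bounded operators \<open>x\<close>, act by
  $x \mapsto \sum_k \langle x \xi_k, \eta_k \rangle$ with $\sum_k \|\xi_k\|^2 < \infty$ and
  $\sum_k \|\eta_k\|^2 < \infty$.\<close>

definition normal_functionals :: "(('h::complex_hilbert \<Rightarrow>\<^sub>L 'h) \<Rightarrow> complex) set" where
  "normal_functionals = {\<lambda>x. \<Sum>k. cinner (blinfun_apply x (\<xi> k)) (\<eta> k) | \<xi> \<eta> :: nat \<Rightarrow> 'h.
     summable (\<lambda>k. (norm (\<xi> k))\<^sup>2) \<and> summable (\<lambda>k. (norm (\<eta> k))\<^sup>2)}"

definition weak_star_topology :: "('h::complex_hilbert \<Rightarrow>\<^sub>L 'h) topology" where
  "weak_star_topology = topology_generated_by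
     {{x \<in> complex_operators. \<phi> x \<in> V} | \<phi> V. \<phi> \<in> normal_functionals \<and> open V}"

definition nc_torus :: "('a::cstar_algebra \<Rightarrow> ('h::complex_hilbert \<Rightarrow>\<^sub>L 'h)) \<Rightarrow> ('h \<Rightarrow>\<^sub>L 'h) set" where
  "nc_torus \<pi> = weak_star_topology closure_of (range \<pi>)"

definition normal_faithful_tracial_state ::
    "('h::complex_hilbert \<Rightarrow>\<^sub>L 'h) set \<Rightarrow> (('h \<Rightarrow>\<^sub>L 'h) \<Rightarrow> complex) \<Rightarrow> bool" where
  "normal_faithful_tracial_state M \<tau> \<longleftrightarrow>
     (\<forall>x\<in>M. \<forall>y\<in>M. \<tau> (x + y) = \<tau> x + \<tau> y) \<and> (\<forall>c. \<forall>x\<in>M. \<tau> (op_scaleC c x) = c * \<tau> x) \<and>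
     (\<forall>x\<in>M. \<tau> (op_adjoint x o\<^sub>L x) \<in> \<real>\<^sub>\<ge>\<^sub>0) \<and> \<tau> id_blinfun = 1 \<and>
     (\<forall>x\<in>M. \<forall>y\<in>M. \<tau> (x o\<^sub>L y) = \<tau> (y o\<^sub>L x)) \<and>
     (\<forall>x\<in>M. \<tau> (op_adjoint x o\<^sub>L x) = 0 \<longrightarrow> x = 0) \<and>
     continuous_map (subtopology weak_star_topology M) euclidean \<tau>"


section \<open>The noncommutative $L_2$-space\<close>

text \<open>The Hilbert space \<open>'l\<close> is the completion of \<open>M\<close>, embedded by \<open>\<iota>\<close>, in the norm
  $\tau(|x|^2)^{1/2} = \tau(x^* x)^{1/2}$.\<close>

definition nc_L2_space ::
    "('h::complex_hilbert \<Rightarrow>\<^sub>L 'h) set \<Rightarrow> (('h \<Rightarrow>\<^sub>L 'h) \<Rightarrow> complex) \<Rightarrow>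
     (('h \<Rightarrow>\<^sub>L 'h) \<Rightarrow> 'l::complex_hilbert) \<Rightarrow> bool" where
  "nc_L2_space M \<tau> \<iota> \<longleftrightarrow>
     (\<forall>x\<in>M. \<forall>y\<in>M. \<iota> (x + y) = \<iota> x + \<iota> y) \<and> (\<forall>c. \<forall>x\<in>M. \<iota> (op_scaleC c x) = c *\<^sub>C \<iota> x) \<and>
     (\<forall>x\<in>M. norm (\<iota> x) = sqrt (Re (\<tau> (op_adjoint x o\<^sub>L x)))) \<and>
     closure (\<iota> ` M) = UNIV"

text \<open>The coefficient $\tau(x (e_n)^*)$ for an element \<open>x\<close> of $L_2$: the functional
  $y \mapsto \tau(y (e_n)^*)$ on \<open>M\<close> is extended to $L_2$ by continuity. Here \<open>e\<close> is $e_n$ as an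
  element of \<open>M\<close>.\<close>

definition fourier_coeff ::
    "('h::complex_hilbert \<Rightarrow>\<^sub>L 'h) set \<Rightarrow> (('h \<Rightarrow>\<^sub>L 'h) \<Rightarrow> complex) \<Rightarrow>
     (('h \<Rightarrow>\<^sub>L 'h) \<Rightarrow> 'l::complex_hilbert) \<Rightarrow> ('h \<Rightarrow>\<^sub>L 'h) \<Rightarrow> 'l \<Rightarrow> complex" where
  "fourier_coeff M \<tau> \<iota> e x =
     Lim (inf (filtercomap \<iota> (nhds x)) (principal M)) (\<lambda>y. \<tau> (y o\<^sub>L op_adjoint e))"


section \<open>The mild solution\<close>

definition mittag_leffler :: "real \<Rightarrow> complex \<Rightarrow> complex" where
  "mittag_leffler \<alpha> z = (\<Sum>k. z ^ k / complex_of_real (Gamma (\<alpha> * real k + 1)))"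

text \<open>The eigenvalue $(1 + |n|^2)^{s/2}$ of $(1 - \Delta_\theta)^{s/2}$ at $e_n$.\<close>

definition bessel_symbol :: "real \<Rightarrow> int ^ 'd::finite \<Rightarrow> real" where
  "bessel_symbol s n = (1 + (\<Sum>k\<in>UNIV. (real_of_int (n $ k))\<^sup>2)) powr (s / 2)"

definition mild_solution ::
    "('d::{finite,linorder} \<Rightarrow> 'a::cstar_algebra) \<Rightarrow> ('a \<Rightarrow> ('h::complex_hilbert \<Rightarrow>\<^sub>L 'h)) \<Rightarrow>
     (('h \<Rightarrow>\<^sub>L 'h) \<Rightarrow> complex) \<Rightarrow> (('h \<Rightarrow>\<^sub>L 'h) \<Rightarrow> 'l::complex_hilbert) \<Rightarrow>
     real \<Rightarrow> real \<Rightarrow> 'l \<Rightarrow> (real \<Rightarrow> 'l) \<Rightarrow> bool" where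
  "mild_solution U \<pi> \<tau> \<iota> s \<alpha> u\<^sub>0 u \<longleftrightarrow> u 0 = u\<^sub>0 \<and>
     (\<forall>t>0. ((\<lambda>n. (mittag_leffler \<alpha> (of_real (- (t powr \<alpha>) * bessel_symbol s n)) *
                   fourier_coeff (nc_torus \<pi>) \<tau> \<iota> (\<pi> (monomial U n)) u\<^sub>0)
                *\<^sub>C \<iota> (\<pi> (monomial U n))) has_sum u t) UNIV)"

end

theory Submission
  imports Defs
begin

text \<open>The trace on the von Neumann algebra induces the inner product of $L_2$, so the Fourier
  coefficients of $u_0$ are inner products with the monomials $e_n$. These are orthonormal, because
  $e_m^* e_n$ is a multiple of $e_{n-m}$. By Bessel's inequality the norm of $u(t)$ is at most
  $\|u_0\|$ times the supremum of $|E_\alpha(-t^\alpha \lambda)|$ over the eigenvalues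
  $\lambda \ge 1$, and it remains to see that $x |E_\alpha(-x)|$ is bounded on $x > 0$.
  For $\alpha < 1$, write the equation $\partial_t^\alpha (y - 1) = -y$ of
  $y(t) = E_\alpha(-t^\alpha)$ with the Marchaud form of the fractional derivative,
  \[ -\Gamma(1 - \alpha)\, y(t) = t^{-\alpha} (y(t) - 1)
     + \alpha \int_0^t (t - r)^{-\alpha - 1} (y(t) - y(r))\, dr. \]
  At a maximum of $|y|$ it forces $|y| \le 1$, and at a maximum of $t^\alpha |y(t)|$ it bounds that
  maximum.\<close>


section \<open>Decay of the Mittag-Leffler function\<close>

text \<open>The Marchaud form looks only backwards: its integrand compares y(t) with y(r) for r < t.
  A maximum over a compact interval therefore suffices, and the resulting bound does not depend on
  the length of that interval. The kernel (t-r)^(-alpha-1) is not integrable at r = t. In the second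
  maximum argument the maximality of x |E_alpha(-x)| itself supplies the missing factor t-r near r =
  t, while away from r = t the bound |E_alpha(-x)| <= 1 from the first argument is enough. At alpha
  = 1 the factor Gamma(1-alpha) has a pole, and the function is exp(-x) instead.

  On the operator side, the torus algebra is given only as a closure and adjoints only by a definite
  description. Existence of adjoints comes from the Riesz theorem, and stability under the algebra
  operations from weak-* continuity; both are needed before the trace laws apply to products such as
  x* y. The Fourier coefficients are limits taken along the algebra, so density is what identifies
  them with inner products.\<close>

lemma powr_mult_exp_le_Gamma:
  fixes R z :: real
  assumes "R > 0" "z \<ge> 0"
  shows "R powr z * exp (- R) \<le> Gamma (z + 1)"
proof -
  have 1: "((\<lambda>t. R powr z * exp (- 1 * t)) has_integral R powr z * (exp (- 1 * R) / 1)) {R..}"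
    by (intro has_integral_mult_right has_integral_exp_minus_to_infinity) simp
  have 2: "((\<lambda>t. t powr (z + 1 - 1) / exp t) has_integral Gamma (z + 1)) {0..}"
    using assms by (intro Gamma_integral_real) simp
  \<comment> \<open>On the tail t \<ge> R the constant R powr z is at most t powr z; extension by 0
    puts both integrals on the same half-line.\<close>
  have 3: "((\<lambda>t. if t \<in> {R..} then R powr z * exp (- 1 * t) else 0) has_integral R powr z * (exp (- 1 * R) / 1)) {0..}"
    using 1 assms by (subst has_integral_restrict) auto
  have "R powr z * (exp (- 1 * R) / 1) \<le> Gamma (z + 1)"
    by (rule has_integral_le[OF 3 2])
       (use assms in \<open>auto simp: exp_minus field_simps powr_mono2\<close>)
  then show ?thesis by simp
qed

text \<open>R is chosen so that R powr \<alpha> = 2|x| + 1. The lower bound for Gamma then grows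
  like (2|x| + 1)^k, which leaves a geometric series of ratio 1/2; the summand 1 keeps R positive at
  x = 0.\<close>

lemma summable_Gamma_series:
  fixes \<alpha> x :: real
  assumes "\<alpha> > 0"
  shows "summable (\<lambda>k. x ^ k / Gamma (\<alpha> * real k + 1))"
proof (rule summable_comparison_test')
  define R where "R = (2 * \<bar>x\<bar> + 1) powr (1 / \<alpha>)"
  have R: "R > 0" "R powr \<alpha> = 2 * \<bar>x\<bar> + 1"
    using assms by (auto simp: R_def powr_powr)
  show "summable (\<lambda>k. exp R * (1 / 2) ^ k :: real)"
    by (intro summable_mult summable_geometric) simp
  fix k :: nat
  have "R powr (\<alpha> * real k) * exp (- R) \<le> Gamma (\<alpha> * real k + 1)"
    using assms R by (intro powr_mult_exp_le_Gamma) auto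
  moreover have "R powr (\<alpha> * real k) = (2 * \<bar>x\<bar> + 1) ^ k"
    using R by (simp add: powr_powr[symmetric] powr_realpow)
  moreover have "(2 * \<bar>x\<bar>) ^ k \<le> (2 * \<bar>x\<bar> + 1) ^ k"
    by (intro power_mono) auto
  ultimately have *: "(2 * \<bar>x\<bar>) ^ k * exp (- R) \<le> Gamma (\<alpha> * real k + 1)"
    by (metis exp_ge_zero mult_right_mono order_trans)
  have G: "Gamma (\<alpha> * real k + 1) > 0"
    using assms by (intro Gamma_real_pos) (simp add: add_nonneg_pos)
  show "norm (x ^ k / Gamma (\<alpha> * real k + 1)) \<le> exp R * (1 / 2) ^ k"
    using * G by (simp add: field_simps power_mult_distrib power_abs exp_minus)
qed

text \<open>The sign of the argument is absorbed into the coefficients, so that E_\<alpha>(-x)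
  becomes a real power series in x that converges everywhere, and its continuity is that of a power
  series.\<close>

definition mittag_coeff :: "real \<Rightarrow> nat \<Rightarrow> real" where
  "mittag_coeff \<alpha> k = (- 1) ^ k / Gamma (\<alpha> * real k + 1)"

definition mittag_neg :: "real \<Rightarrow> real \<Rightarrow> real" where
  "mittag_neg \<alpha> x = (\<Sum>k. mittag_coeff \<alpha> k * x ^ k)"

lemma mittag_coeff_0 [simp]: "mittag_coeff \<alpha> 0 = 1"
  by (simp add: mittag_coeff_def)

lemma summable_mittag_coeff:
  assumes "\<alpha> > 0"
  shows "summable (\<lambda>k. mittag_coeff \<alpha> k * x ^ k)"
proof -
  have "(\<lambda>k. mittag_coeff \<alpha> k * x ^ k) = (\<lambda>k. (- x) ^ k / Gamma (\<alpha> * real k + 1))"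
    by (auto simp: mittag_coeff_def power_minus[of x])
  then show ?thesis using summable_Gamma_series[OF assms, of "- x"] by simp
qed

lemma summable_abs_mittag_coeff:
  assumes "\<alpha> > 0" "x \<ge> 0"
  shows "summable (\<lambda>k. \<bar>mittag_coeff \<alpha> k\<bar> * x ^ k)"
proof -
  have "Gamma (\<alpha> * real k + 1) > 0" for k
    using assms by (intro Gamma_real_pos) (simp add: add_nonneg_pos)
  then have "(\<lambda>k. \<bar>mittag_coeff \<alpha> k\<bar> * x ^ k) = (\<lambda>k. x ^ k / Gamma (\<alpha> * real k + 1))"
    by (auto simp: mittag_coeff_def less_imp_le)
  then show ?thesis using summable_Gamma_series[OF assms(1), of x] by simp
qed

lemma mittag_leffler_neg:
  assumes "\<alpha> > 0"
  shows "mittag_leffler \<alpha> (of_real (- x)) = of_real (mittag_neg \<alpha> x)"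
proof -
  have "(\<lambda>k. complex_of_real (- x) ^ k / complex_of_real (Gamma (\<alpha> * real k + 1)))
      = (\<lambda>k. of_real (mittag_coeff \<alpha> k * x ^ k))"
    by (auto simp: mittag_coeff_def power_minus[of "of_real x"])
  then show ?thesis
    unfolding mittag_leffler_def mittag_neg_def
    by (simp only: suminf_of_real[OF summable_mittag_coeff[OF assms]])
qed

lemma continuous_on_mittag_neg:
  assumes "\<alpha> > 0"
  shows "continuous_on S (mittag_neg \<alpha>)"
proof -
  have "isCont (mittag_neg \<alpha>) x" for x
    unfolding mittag_neg_def
    by (rule isCont_powser_converges_everywhere) (rule summable_mittag_coeff[OF assms])
  then show ?thesis by (simp add: continuous_at_imp_continuous_on)
qed

section \<open>The Marchaud equation\<close>

text \<open>Since v \<le> v powr \<alpha> on (0,1), this is Bernoulli's inequality at v - 1. The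
  factor 1 - v lowers the singularity (1-v) powr (-\<alpha>-1) to the integrable (1-v) powr
  (-\<alpha>).\<close>

lemma one_minus_powr_le:
  fixes v \<alpha> :: real
  assumes "0 < v" "v < 1" "\<alpha> \<le> 1"
  shows "1 - (v powr \<alpha>) ^ k \<le> real k * (1 - v)"
proof -
  have "v powr 1 \<le> v powr \<alpha>" using assms by (intro powr_mono') auto
  then have "v ^ k \<le> (v powr \<alpha>) ^ k" using assms by (intro power_mono) auto
  moreover have "1 + real k * (v - 1) \<le> (1 + (v - 1)) ^ k"
    using assms by (intro Bernoulli_inequality) auto
  ultimately show ?thesis by (simp add: algebra_simps)
qed

text \<open>Integration by parts of $(1-v)^{-\alpha} (1-v^{\alpha k})$ reduces this to a Beta integral.\<close>

lemma has_integral_marchaud_power: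
  fixes \<alpha> :: real
  assumes a: "0 < \<alpha>" "\<alpha> < 1" and k: "k > 0"
  shows "((\<lambda>v. \<alpha> * ((1 - v) powr (- \<alpha> - 1) * (1 - (v powr \<alpha>) ^ k))) has_integral
     (Gamma (1 - \<alpha>) * Gamma (\<alpha> * real k + 1) / Gamma (\<alpha> * real (k - 1) + 1) - 1)) {0<..<1}"
proof -
  define \<beta> where "\<beta> = \<alpha> * real k"
  have b: "\<beta> > 0" using a k by (simp add: \<beta>_def)
  define G where "G v = (1 - v) powr (- \<alpha>) * (1 - v powr \<beta>)" for v :: real
  have pw: "(v powr \<alpha>) ^ k = v powr \<beta>" if "v > 0" for v
    using that by (simp add: \<beta>_def powr_powr[symmetric] powr_realpow)
  have "((\<lambda>v. \<alpha> * ((1 - v) powr (- \<alpha> - 1) * (1 - v powr \<beta>)) - \<beta> * (v powr (\<beta> - 1) * (1 - v) powr (1 - \<alpha> - 1)))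
      has_integral G 1 - G 0) {0..1}"
  \<comment> \<open>Differentiability may fail at the endpoints, so the theorem is used in the form
    that asks only for continuity there.\<close>
  proof (rule fundamental_theorem_of_calculus_interior)
    have "continuous (at v within {0..1}) G" if v: "v \<in> {0..1}" for v
    proof (cases "v = 1")
      case False
      have "continuous_on {0..<1} G"
        unfolding G_def using b by (intro continuous_intros continuous_on_powr') auto
      then have "continuous (at v within {0..<1}) G"
        using v False by (simp add: continuous_on_eq_continuous_within)
      moreover have "at v within {0..<1} = at v within {0..1}"
        using v False by (intro at_within_nhd[of _ "{..<1}"]) auto
      ultimately show ?thesis by simp
    next
      case True
      \<comment> \<open>At v = 1 the first factor of \<open>G\<close> blows up, but the estimate on
        1 - v powr \<beta> bounds the product by k (1-v) powr (1-\<alpha>), which tends to 0, the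
        value of \<open>G 1\<close>.\<close>
      have "(G \<longlongrightarrow> 0) (at 1 within {0..1})"
      proof (rule tendsto_0_le[where K = 1])
        have "((\<lambda>v::real. real k * (1 - v) powr (1 - \<alpha>)) \<longlongrightarrow> real k * (1 - 1) powr (1 - \<alpha>)) (at 1 within {0..1})"
          using a by (intro tendsto_intros tendsto_powr') (auto simp: eventually_at_filter)
        then show "((\<lambda>v::real. real k * (1 - v) powr (1 - \<alpha>)) \<longlongrightarrow> 0) (at 1 within {0..1})"
          using a by simp
        have "norm (G v) \<le> real k * (1 - v) powr (1 - \<alpha>)" if "v > 0" "v < 1" for v
        proof -
          have "v powr \<beta> \<le> 1" using that b by (simp add: powr_le1)
          then have "norm (G v) = (1 - v) powr (- \<alpha>) * (1 - v powr \<beta>)"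
            by (simp add: G_def abs_mult)
          also have "\<dots> \<le> (1 - v) powr (- \<alpha>) * (real k * (1 - v))"
            using one_minus_powr_le[of v \<alpha> k] that a pw by (intro mult_left_mono) auto
          also have "\<dots> = real k * (1 - v) powr (1 - \<alpha>)"
            using that by (simp add: powr_diff powr_minus field_simps)
          finally show ?thesis .
        qed
        then show "\<forall>\<^sub>F v in at 1 within {0..1}. norm (G v) \<le> norm (real k * (1 - v) powr (1 - \<alpha>)) * 1"
          by (auto simp: eventually_at intro!: exI[of _ 1] simp: dist_real_def)
      qed
      then show ?thesis using True by (simp add: continuous_within G_def)
    qed
    then show "continuous_on {0..1} G" by (simp add: continuous_on_eq_continuous_within)
  next
    fix v :: real assume v: "v \<in> {0<..<1}"
    have "(G has_real_derivative \<alpha> * ((1 - v) powr (- \<alpha> - 1) * (1 - v powr \<beta>)) -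
         \<beta> * (v powr (\<beta> - 1) * (1 - v) powr (1 - \<alpha> - 1))) (at v)"
      unfolding G_def using v
      by (auto intro!: derivative_eq_intros simp: algebra_simps)
    then show "(G has_vector_derivative \<alpha> * ((1 - v) powr (- \<alpha> - 1) * (1 - v powr \<beta>)) -
         \<beta> * (v powr (\<beta> - 1) * (1 - v) powr (1 - \<alpha> - 1))) (at v)"
      by (simp add: has_real_derivative_iff_has_vector_derivative)
  qed simp
  \<comment> \<open>The boundary term is G 1 - G 0 = 0 - 1, because 0 powr \<beta> = 0.\<close>
  then have 1: "((\<lambda>v. \<alpha> * ((1 - v) powr (- \<alpha> - 1) * (1 - v powr \<beta>)) - \<beta> * (v powr (\<beta> - 1) * (1 - v) powr (1 - \<alpha> - 1)))
      has_integral - 1) {0..1}" by (simp add: G_def)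
  have 2: "((\<lambda>v. \<beta> * (v powr (\<beta> - 1) * (1 - v) powr (1 - \<alpha> - 1))) has_integral \<beta> * Beta \<beta> (1 - \<alpha>)) {0..1}"
    using a b by (intro has_integral_mult_right has_integral_Beta_real) auto
  \<comment> \<open>Here \<beta> Gamma(\<beta>) = Gamma(\<beta> + 1), and \<beta> + 1 - \<alpha> =
    \<alpha> (k-1) + 1.\<close>
  have e: "\<beta> * Beta \<beta> (1 - \<alpha>) = Gamma (1 - \<alpha>) * Gamma (\<alpha> * real k + 1) / Gamma (\<alpha> * real (k - 1) + 1)"
    using b k Gamma_plus1[of \<beta>]
    by (auto simp: Beta_def \<beta>_def of_nat_diff algebra_simps nonpos_Ints_def)
  have "((\<lambda>v. \<alpha> * ((1 - v) powr (- \<alpha> - 1) * (1 - v powr \<beta>))) has_integral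
     (Gamma (1 - \<alpha>) * Gamma (\<alpha> * real k + 1) / Gamma (\<alpha> * real (k - 1) + 1) - 1)) {0..1}"
    using has_integral_add[OF 1 2] by (simp add: e)
  then show ?thesis
    unfolding has_integral_Icc_iff_Ioo
    by (rule has_integral_eq[rotated]) (simp add: pw)
qed

lemma has_integral_one_minus_powr:
  fixes \<alpha> :: real
  assumes "\<alpha> < 1"
  shows "((\<lambda>v. (1 - v) powr (- \<alpha>)) has_integral Beta 1 (1 - \<alpha>)) {0<..<1}"
proof -
  have "((\<lambda>v. v powr (1 - 1) * (1 - v) powr (1 - \<alpha> - 1)) has_integral Beta 1 (1 - \<alpha>)) {0..1}"
    using assms by (intro has_integral_Beta_real) auto
  then show ?thesis
    unfolding has_integral_Icc_iff_Ioo by (rule has_integral_eq[rotated]) simp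
qed

text \<open>The equation of the introduction, with $x = t^\alpha$ and $r = t v$.\<close>

lemma mittag_neg_marchaud:
  fixes \<alpha> x :: real
  assumes a: "0 < \<alpha>" "\<alpha> < 1" and x: "x \<ge> 0"
  shows "((\<lambda>v. \<alpha> * ((1 - v) powr (- \<alpha> - 1) * (mittag_neg \<alpha> x - mittag_neg \<alpha> (x * v powr \<alpha>)))) has_integral
     (1 - mittag_neg \<alpha> x - Gamma (1 - \<alpha>) * (x * mittag_neg \<alpha> x))) {0<..<1}"
proof -
  define c where "c = mittag_coeff \<alpha>"
  \<comment> \<open>The index 0 is separate: \<open>e 0\<close> vanishes, whereas the closed
    formula, with 0 - 1 = 0 on naturals, would give Gamma(1-\<alpha>) - 1.\<close>
  define J where "J k = (if k = 0 then 0 else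
     Gamma (1 - \<alpha>) * Gamma (\<alpha> * real k + 1) / Gamma (\<alpha> * real (k - 1) + 1) - 1)" for k
  define e where "e k v = \<alpha> * ((1 - v) powr (- \<alpha> - 1) * (1 - (v powr \<alpha>) ^ k))" for k v
  define f where "f N v = (\<Sum>k<N. c k * x ^ k * e k v)" for N v
  \<comment> \<open>A dominating function for all partial sums: 1 - (v powr \<alpha>)^k \<le> k
    (1-v) \<le> 2^k (1-v), and the factor 2^k is absorbed by evaluating the absolutely convergent
    series at 2x.\<close>
  define h where "h v = (\<Sum>k. \<bar>c k\<bar> * (2 * x) ^ k) * (\<alpha> * (1 - v) powr (- \<alpha>))" for v
  define g where "g v = \<alpha> * ((1 - v) powr (- \<alpha> - 1) * (mittag_neg \<alpha> x - mittag_neg \<alpha> (x * v powr \<alpha>)))" for v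
  have sm: "(\<lambda>k. c k * y ^ k) sums mittag_neg \<alpha> y" for y
    unfolding c_def mittag_neg_def using summable_mittag_coeff[OF a(1)] by (rule summable_sums)
  have sa: "summable (\<lambda>k. \<bar>c k\<bar> * (2 * x) ^ k)"
    unfolding c_def using x a by (intro summable_abs_mittag_coeff) auto
  have e: "(e k has_integral J k) {0<..<1}" for k
    using has_integral_marchaud_power[OF a, of k]
    by (cases "k = 0") (simp_all add: e_def[abs_def] J_def)
  have fi: "(f N has_integral (\<Sum>k<N. c k * x ^ k * J k)) {0<..<1}" for N
    unfolding f_def[abs_def] by (intro has_integral_sum has_integral_mult_right e) auto
  have hi: "h integrable_on {0<..<1}"
    unfolding h_def[abs_def]
    using has_integral_mult_right[OF has_integral_mult_right[OF has_integral_one_minus_powr[OF a(2)]]]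
    by (rule has_integral_integrable)
  have e_le: "\<bar>e k v\<bar> \<le> 2 ^ k * (\<alpha> * (1 - v) powr (- \<alpha>))" if v: "v \<in> {0<..<1}" for k v
  proof -
    have "v powr \<alpha> \<le> 1" using v a by (simp add: powr_le1)
    then have p: "(v powr \<alpha>) ^ k \<le> 1" by (simp add: power_le_one)
    have "real k \<le> 2 ^ k" by (metis less_imp_le of_nat_less_two_power)
    then have "1 - (v powr \<alpha>) ^ k \<le> 2 ^ k * (1 - v)"
      using one_minus_powr_le[of v \<alpha> k] v a
      by (intro order_trans[OF one_minus_powr_le mult_right_mono]) auto
    then have "(1 - v) powr (- \<alpha> - 1) * (1 - (v powr \<alpha>) ^ k) \<le> (1 - v) powr (- \<alpha> - 1) * (2 ^ k * (1 - v))"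
      by (intro mult_left_mono) auto
    also have "\<dots> = 2 ^ k * (1 - v) powr (- \<alpha>)"
      using v by (simp add: powr_diff field_simps)
    finally show ?thesis using a p by (simp add: e_def abs_mult)
  qed
  have le: "norm (f N v) \<le> h v" if v: "v \<in> {0<..<1}" for N v
  proof -
    have "norm (f N v) \<le> (\<Sum>k<N. \<bar>c k\<bar> * x ^ k * \<bar>e k v\<bar>)"
      unfolding f_def using x by (intro order_trans[OF norm_sum]) (simp add: abs_mult)
    also have "\<dots> \<le> (\<Sum>k<N. \<bar>c k\<bar> * x ^ k * (2 ^ k * (\<alpha> * (1 - v) powr (- \<alpha>))))"
      using x by (intro sum_mono mult_left_mono e_le v) auto
    also have "\<dots> = (\<Sum>k<N. \<bar>c k\<bar> * (2 * x) ^ k) * (\<alpha> * (1 - v) powr (- \<alpha>))"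
      by (simp add: sum_distrib_right sum_distrib_left power_mult_distrib mult_ac)
    also have "\<dots> \<le> h v"
      unfolding h_def using a x by (intro mult_right_mono sum_le_suminf sa) auto
    finally show ?thesis .
  qed
  have conv: "(\<lambda>N. f N v) \<longlonglongrightarrow> g v" if v: "v \<in> {0<..<1}" for v
  proof -
    have "(\<lambda>k. \<alpha> * ((1 - v) powr (- \<alpha> - 1) * (c k * x ^ k - c k * (x * v powr \<alpha>) ^ k))) sums g v"
      unfolding g_def by (intro sums_mult sums_diff sm)
    then show ?thesis
      unfolding sums_def f_def e_def by (simp add: power_mult_distrib algebra_simps)
  qed
  note dc = dominated_convergence[OF has_integral_integrable[OF fi] hi le conv]
  have "(\<lambda>N. \<Sum>k<N. c k * x ^ k * J k) \<longlonglongrightarrow> integral {0<..<1} g"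
    using dc(2) by (simp only: integral_unique[OF fi])
  moreover have "(\<lambda>k. c k * x ^ k * J k) sums (- (Gamma (1 - \<alpha>) * x) * mittag_neg \<alpha> x - (mittag_neg \<alpha> x - c 0 * x ^ 0) + 0)"
  proof -
    have G: "Gamma (\<alpha> * real k + 1) > 0" for k
      using a by (intro Gamma_real_pos) (simp add: add_nonneg_pos)
    \<comment> \<open>The coefficient cancels Gamma(\<alpha>(k+1)+1), and dividing by
      Gamma(\<alpha>k+1) leaves minus the preceding coefficient. Integration thus shifts the series
      by one index, which produces the term x E_\<alpha>(-x).\<close>
    have eq: "c (Suc k) * x ^ Suc k * J (Suc k) = - (Gamma (1 - \<alpha>) * x) * (c k * x ^ k) - c (Suc k) * x ^ Suc k" for k
      using G[of "Suc k"] G[of k] by (simp add: c_def mittag_coeff_def J_def field_simps)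
    have "(\<lambda>k. c (Suc k) * x ^ Suc k) sums (mittag_neg \<alpha> x - c 0 * x ^ 0)"
      by (subst sums_Suc_iff) (use sm in auto)
    then have "(\<lambda>k. c (Suc k) * x ^ Suc k * J (Suc k)) sums
       (- (Gamma (1 - \<alpha>) * x) * mittag_neg \<alpha> x - (mittag_neg \<alpha> x - c 0 * x ^ 0))"
      unfolding eq by (intro sums_diff sums_mult sm)
    then show ?thesis by (subst (asm) sums_Suc_iff) (simp add: J_def)
  qed
  ultimately have "integral {0<..<1} g = 1 - mittag_neg \<alpha> x - Gamma (1 - \<alpha>) * (x * mittag_neg \<alpha> x)"
    unfolding sums_def by (auto dest: LIMSEQ_unique simp: c_def algebra_simps)
  then have "(g has_integral 1 - mittag_neg \<alpha> x - Gamma (1 - \<alpha>) * (x * mittag_neg \<alpha> x)) {0<..<1}"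
    using integrable_integral[OF dc(1)] by simp
  then show ?thesis unfolding g_def[abs_def] .
qed

section \<open>Bounds from maximum arguments\<close>

text \<open>For x maximizing the absolute value on [0,X], every point x v powr \<alpha> also lies in
  [0,X]. The Marchaud integral, multiplied by the sign of the value at x, is therefore nonnegative,
  and the equation leaves no room for an absolute value above 1.\<close>

lemma abs_mittag_neg_le_1:
  fixes \<alpha> X :: real
  assumes a: "0 < \<alpha>" "\<alpha> < 1" and X: "X \<ge> 0"
  shows "\<bar>mittag_neg \<alpha> X\<bar> \<le> 1"
proof (rule ccontr)
  assume X1: "\<not> \<bar>mittag_neg \<alpha> X\<bar> \<le> 1"
  let ?g = "mittag_neg \<alpha>"
  have "continuous_on {0..X} (\<lambda>x. \<bar>?g x\<bar>)"
    using a by (intro continuous_intros continuous_on_mittag_neg)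
  then obtain x where x: "x \<in> {0..X}" and mx: "\<And>y. y \<in> {0..X} \<Longrightarrow> \<bar>?g y\<bar> \<le> \<bar>?g x\<bar>"
    using continuous_attains_sup[of "{0..X}" "\<lambda>x. \<bar>?g x\<bar>"] X by auto
  have gt: "\<bar>?g x\<bar> > 1" using mx[of X] X X1 by auto
  \<comment> \<open>The sign treats a positive maximum and a negative minimum together.\<close>
  define \<sigma> where "\<sigma> = sgn (?g x)"
  have s: "\<sigma> * ?g x = \<bar>?g x\<bar>" "\<bar>\<sigma>\<bar> = 1" using gt by (auto simp: \<sigma>_def sgn_if)
  have "0 \<le> \<sigma> * (1 - ?g x - Gamma (1 - \<alpha>) * (x * ?g x))"
  proof (rule has_integral_nonneg[OF has_integral_mult_right[OF mittag_neg_marchaud[OF a]]])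
    fix v :: real assume v: "v \<in> {0<..<1}"
    have "v powr \<alpha> \<le> 1" using v a by (simp add: powr_le1)
    then have "x * v powr \<alpha> \<le> x * 1" using x by (intro mult_left_mono) auto
    then have "\<bar>?g (x * v powr \<alpha>)\<bar> \<le> \<bar>?g x\<bar>" using x by (intro mx) auto
    moreover have "\<sigma> * ?g (x * v powr \<alpha>) \<le> \<bar>?g (x * v powr \<alpha>)\<bar>"
      using s(2) by (metis abs_ge_self abs_mult mult_1)
    ultimately have "0 \<le> \<sigma> * (?g x - ?g (x * v powr \<alpha>))" using s by (simp add: algebra_simps)
    then have "0 \<le> \<alpha> * ((1 - v) powr (- \<alpha> - 1) * (\<sigma> * (?g x - ?g (x * v powr \<alpha>))))"
      using a by simp
    then show "0 \<le> \<sigma> * (\<alpha> * ((1 - v) powr (- \<alpha> - 1) * (?g x - ?g (x * v powr \<alpha>))))"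
      by (simp add: mult_ac)
  qed (use x in auto)
  also have "\<dots> = \<sigma> - \<bar>?g x\<bar> - Gamma (1 - \<alpha>) * (x * \<bar>?g x\<bar>)"
    by (simp add: s(1)[symmetric] algebra_simps)
  finally have "0 \<le> \<sigma> - \<bar>?g x\<bar> - Gamma (1 - \<alpha>) * (x * \<bar>?g x\<bar>)" .
  moreover have "Gamma (1 - \<alpha>) * (x * \<bar>?g x\<bar>) \<ge> 0"
    using a x Gamma_real_pos[of "1 - \<alpha>"] by simp
  ultimately show False using gt s(2) by linarith
qed

text \<open>At a maximum of x |E_\<alpha>(-x)| on [0,X] the Marchaud integral is bounded below. For
  v < 1/2 the kernel is at most (1/2) powr (-2) = 4 and the signed difference is at least -1, which
  gives the 4. For v \<ge> 1/2 the difference is at least -(1-v), which leaves (1-v) powr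
  (-\<alpha>) and is covered by the Beta term. The leading 1 bounds the sign \<sigma>.\<close>

lemma mittag_neg_decay:
  fixes \<alpha> X :: real
  assumes a: "0 < \<alpha>" "\<alpha> < 1" and X: "X \<ge> 0"
  shows "X * \<bar>mittag_neg \<alpha> X\<bar> \<le> (1 + \<alpha> * (4 + 2 * Beta 1 (1 - \<alpha>))) / Gamma (1 - \<alpha>)"
proof -
  let ?g = "mittag_neg \<alpha>" and ?C = "1 + \<alpha> * (4 + 2 * Beta 1 (1 - \<alpha>))"
  have "continuous_on {0..X} (\<lambda>x. x * \<bar>?g x\<bar>)"
    using a by (intro continuous_intros continuous_on_mittag_neg)
  then obtain x where x: "x \<in> {0..X}" and mx: "\<And>y. y \<in> {0..X} \<Longrightarrow> y * \<bar>?g y\<bar> \<le> x * \<bar>?g x\<bar>"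
    using continuous_attains_sup[of "{0..X}" "\<lambda>x. x * \<bar>?g x\<bar>"] X by auto
  have G: "Gamma (1 - \<alpha>) > 0" using a by (intro Gamma_real_pos) simp
  have B: "Beta 1 (1 - \<alpha>) \<ge> 0"
    using has_integral_one_minus_powr[OF a(2)] by (rule has_integral_nonneg) auto
  have "Gamma (1 - \<alpha>) * (x * \<bar>?g x\<bar>) \<le> ?C"
  proof (cases "?g x = 0")
    case True
    then show ?thesis using B a by simp
  next
    case False
    define \<sigma> where "\<sigma> = sgn (?g x)"
    have s: "\<sigma> * ?g x = \<bar>?g x\<bar>" "\<bar>\<sigma>\<bar> = 1" using False by (auto simp: \<sigma>_def sgn_if)
    have "- \<alpha> * (4 + 2 * Beta 1 (1 - \<alpha>)) \<le> \<sigma> * (1 - ?g x - Gamma (1 - \<alpha>) * (x * ?g x))"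
    proof (rule has_integral_le[OF _ has_integral_mult_right[OF mittag_neg_marchaud[OF a]]])
      have c: "((\<lambda>v::real. 4::real) has_integral 4) {0<..<1}"
        using has_integral_const_real[of "4::real" 0 1] by (simp add: has_integral_Icc_iff_Ioo)
      show "((\<lambda>v. - \<alpha> * (4 + 2 * (1 - v) powr (- \<alpha>))) has_integral - \<alpha> * (4 + 2 * Beta 1 (1 - \<alpha>))) {0<..<1}"
        by (intro has_integral_mult_right has_integral_add has_integral_one_minus_powr a c)
    next
      fix v :: real assume v: "v \<in> {0<..<1}"
      have v1: "v powr \<alpha> \<le> 1" "v powr \<alpha> > 0" using v a by (simp_all add: powr_le1)
      let ?y = "x * v powr \<alpha>"
      have y: "?y \<in> {0..x}" using x v1 mult_left_mono[of "v powr \<alpha>" 1 x] by auto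
      have sy: "\<sigma> * ?g ?y \<le> \<bar>?g ?y\<bar>"
        using s(2) by (metis abs_ge_self abs_mult mult_1)
      have gy1: "\<bar>?g ?y\<bar> \<le> 1" using y by (intro abs_mittag_neg_le_1 a) auto
      have gx1: "\<bar>?g x\<bar> \<le> 1" using x by (intro abs_mittag_neg_le_1 a) auto
      have "(1 - v) powr (- \<alpha> - 1) * (\<sigma> * (?g x - ?g ?y)) \<ge> - (4 + 2 * (1 - v) powr (- \<alpha>))"
      proof (cases "v < 1 / 2")
        case True
        have "(1 - v) powr (- \<alpha> - 1) \<le> (1 / 2) powr (- \<alpha> - 1)"
          using True a by (intro powr_mono2') auto
        also have "\<dots> \<le> (1 / 2) powr (- 2)" using a by (intro powr_mono') auto
        also have "\<dots> = (4 :: real)" by (simp add: powr_minus powr_numeral power2_eq_square)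
        finally have le4: "(1 - v) powr (- \<alpha> - 1) \<le> 4" .
        have ge: "\<sigma> * (?g x - ?g ?y) \<ge> - 1" using s sy gy1 by (simp add: algebra_simps)
        have "(1 - v) powr (- \<alpha> - 1) * (\<sigma> * (?g x - ?g ?y)) \<ge> (1 - v) powr (- \<alpha> - 1) * - 1"
          using ge by (intro mult_left_mono) auto
        moreover have "(1 - v) powr (- \<alpha>) \<ge> 0" by simp
        ultimately show ?thesis using le4 by linarith
      next
        case False
        \<comment> \<open>Maximality compares ?y = x v powr \<alpha> with x, and the common factor x
          is cancelled. At x = 0 both points coincide. Together with v \<le> v powr \<alpha> this
          yields the factor 1 - v that tames the kernel.\<close>
        have "\<bar>?g ?y\<bar> * v powr \<alpha> \<le> \<bar>?g x\<bar>"
        proof (cases "x = 0")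
          case False
          have "?y * \<bar>?g ?y\<bar> \<le> x * \<bar>?g x\<bar>" using y x by (intro mx) auto
          then have "x * (\<bar>?g ?y\<bar> * v powr \<alpha>) \<le> x * \<bar>?g x\<bar>" by (simp add: mult_ac)
          then show ?thesis using False x by simp
        qed (use v1 in \<open>simp add: mult_left_le\<close>)
        moreover have "v * \<bar>?g ?y\<bar> \<le> \<bar>?g ?y\<bar> * v powr \<alpha>"
          using powr_mono'[of \<alpha> 1 v] v a by (simp add: mult.commute[of _ "v powr \<alpha>"] mult_right_mono)
        ultimately have "v * \<bar>?g ?y\<bar> \<le> \<bar>?g x\<bar>" by linarith
        then have "\<bar>?g ?y\<bar> - \<bar>?g x\<bar> \<le> (1 - v) * \<bar>?g ?y\<bar>" by (simp add: algebra_simps)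
        also have "\<dots> \<le> (1 - v) * 1" using v gy1 by (intro mult_left_mono) auto
        finally have ge: "\<sigma> * (?g x - ?g ?y) \<ge> - (1 - v)" using s sy by (simp add: algebra_simps)
        have "(1 - v) powr (- \<alpha> - 1) * (\<sigma> * (?g x - ?g ?y)) \<ge> (1 - v) powr (- \<alpha> - 1) * - (1 - v)"
          using ge by (intro mult_left_mono) auto
        moreover have "(1 - v) powr (- \<alpha> - 1) * - (1 - v) = - ((1 - v) powr (- \<alpha>))"
          using v by (simp add: powr_diff field_simps)
        moreover have "(1 - v) powr (- \<alpha>) \<ge> 0" by simp
        ultimately show ?thesis by linarith
      qed
      then have "\<alpha> * ((1 - v) powr (- \<alpha> - 1) * (\<sigma> * (?g x - ?g ?y))) \<ge> \<alpha> * - (4 + 2 * (1 - v) powr (- \<alpha>))"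
        using a by (intro mult_left_mono) auto
      then show "- \<alpha> * (4 + 2 * (1 - v) powr (- \<alpha>))
        \<le> \<sigma> * (\<alpha> * ((1 - v) powr (- \<alpha> - 1) * (?g x - ?g ?y)))"
        by (simp only: mult_minus_left mult_minus_right mult.left_commute[of \<sigma>])
    qed (use x in auto)
    also have "\<dots> = \<sigma> - \<bar>?g x\<bar> - Gamma (1 - \<alpha>) * (x * \<bar>?g x\<bar>)"
      by (simp add: s(1)[symmetric] algebra_simps)
    finally show ?thesis using s(2) by (simp add: algebra_simps abs_if split: if_splits)
  qed
  then have "x * \<bar>?g x\<bar> \<le> ?C / Gamma (1 - \<alpha>)"
    using G by (simp add: field_simps)
  then show ?thesis using mx[of X] X by auto
qed

text \<open>The case \<alpha> = 1 is handled through exp(-x) and x + 1 \<le> exp x, since the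
  constant for \<alpha> < 1 comes from a kernel that degenerates there.\<close>

lemma mittag_leffler_decay:
  fixes \<alpha> :: real
  assumes a: "0 < \<alpha>" "\<alpha> \<le> 1"
  obtains C where "C > 0" "\<And>x. x > 0 \<Longrightarrow> cmod (mittag_leffler \<alpha> (of_real (- x))) \<le> C / x"
proof -
  have "\<exists>C. \<forall>x>0. x * \<bar>mittag_neg \<alpha> x\<bar> \<le> C"
  proof (cases "\<alpha> < 1")
    case True
    then show ?thesis using mittag_neg_decay[OF a(1) True] by (meson less_imp_le)
  next
    case False
    have "mittag_neg \<alpha> x = exp (- x)" for x
    proof -
      have "mittag_coeff \<alpha> k * x ^ k = (- x) ^ k /\<^sub>R fact k" for k
        using False a Gamma_fact[of k, where 'a = real]
        by (simp add: mittag_coeff_def power_minus[of x] add.commute divide_inverse)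
      then show ?thesis by (simp add: mittag_neg_def exp_def)
    qed
    moreover have "x * exp (- x) \<le> 1" if "x > 0" for x :: real
      using order_trans[OF _ exp_ge_add_one_self[of x], of x] by (simp add: exp_minus field_simps)
    ultimately show ?thesis by (metis abs_exp_cancel)
  qed
  then obtain C where C: "\<And>x. x > 0 \<Longrightarrow> x * \<bar>mittag_neg \<alpha> x\<bar> \<le> C" by blast
  show ?thesis
  proof
    show "max C 1 > 0" by simp
    show "cmod (mittag_leffler \<alpha> (of_real (- x))) \<le> max C 1 / x" if "x > 0" for x
      using C[OF that] that by (simp only: mittag_leffler_neg[OF a(1)]) (simp add: field_simps)
  qed
qed


section \<open>Inner product and adjoints\<close>

lemma cinner_add_right: "cinner x (y + z) = cinner x y + cinner x (z :: 'h::complex_hilbert)"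
  unfolding cinner_commute[of x] by (simp add: cinner_add_left)

lemma cinner_scaleC_right: "cinner x (c *\<^sub>C y) = cnj c * cinner x (y :: 'h::complex_hilbert)"
  unfolding cinner_commute[of x] by (simp add: cinner_scaleC_left)

lemma cinner_scaleR_left: "cinner (r *\<^sub>R x) y = r *\<^sub>R cinner x (y :: 'h::complex_hilbert)"
  by (simp add: scaleR_scaleC cinner_scaleC_left scaleR_conv_of_real)

text \<open>Reduces identities for the complex inner product to real ones: the imaginary part is a
  real inner product with a rotated argument.\<close>

lemma Im_cinner: "Im (cinner x y) = - ((\<i> *\<^sub>C x) \<bullet> (y :: 'h::complex_hilbert))"
  by (simp add: inner_eq_Re_cinner cinner_scaleC_left)

lemma cinner_self: "cinner x x = of_real ((norm (x :: 'h::complex_hilbert))\<^sup>2)"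
proof (rule complex_eqI)
  have "Im (cinner x x) = - Im (cinner x x)"
    using arg_cong[OF cinner_commute[of x x], of Im] by (simp only: cnj.sel)
  then show "Im (cinner x x) = Im (of_real ((norm x)\<^sup>2))" by simp
qed (simp add: inner_eq_Re_cinner[symmetric] power2_norm_eq_inner)

lemma norm_scaleC_hilbert: "norm (c *\<^sub>C x) = cmod c * norm (x :: 'h::complex_hilbert)"
proof -
  have "complex_of_real ((norm (c *\<^sub>C x))\<^sup>2) = (c * cnj c) * cinner x x"
    by (simp only: cinner_self[symmetric] cinner_scaleC_left cinner_scaleC_right mult.assoc mult.left_commute)
  also have "\<dots> = of_real ((cmod c * norm x)\<^sup>2)"
    by (simp add: cinner_self complex_norm_square[symmetric] power_mult_distrib)
  finally show ?thesis
    by (metis norm_ge_zero mult_nonneg_nonneg of_real_eq_iff power2_eq_imp_eq)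
qed

lemma cmod_cinner_le: "cmod (cinner x y) \<le> norm x * norm (y :: 'h::complex_hilbert)"
proof (cases "cinner x y = 0")
  case False
  \<comment> \<open>This phase rotates x until its inner product with y is real and nonnegative, so
    that the real Cauchy-Schwarz inequality applies.\<close>
  define c where "c = cnj (cinner x y) / of_real (cmod (cinner x y))"
  have c: "cmod c = 1" using False by (simp add: c_def norm_divide)
  have "c * cinner x y = of_real (cmod (cinner x y))"
    using False by (simp add: c_def complex_norm_square[symmetric] power2_eq_square mult.commute[of "cnj _"])
  then have "cmod (cinner x y) = (c *\<^sub>C x) \<bullet> y"
    by (simp add: inner_eq_Re_cinner cinner_scaleC_left)
  also have "\<dots> \<le> norm (c *\<^sub>C x) * norm y" by (rule norm_cauchy_schwarz)
  finally show ?thesis by (simp add: norm_scaleC_hilbert c)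
qed simp

lemma bounded_linear_scaleC: "bounded_linear (\<lambda>x :: 'h::complex_hilbert. c *\<^sub>C x)"
  by (rule bounded_linear_intro[where K = "cmod c"])
     (simp_all add: scaleC_add_right scaleR_scaleC scaleC_scaleC norm_scaleC_hilbert mult.commute)

lemma bounded_linear_cinner_left: "bounded_linear (\<lambda>x. cinner x (y :: 'h::complex_hilbert))"
  by (rule bounded_linear_intro[where K = "norm y"])
     (simp_all add: cinner_add_left cinner_scaleR_left cmod_cinner_le)

lemma cinner_eqI:
  assumes "\<And>\<xi>. cinner \<xi> x = cinner \<xi> (y :: 'h::complex_hilbert)"
  shows "x = y"
proof -
  have "\<xi> \<bullet> (x - y) = 0" for \<xi>
    using assms[of \<xi>] by (simp add: inner_eq_Re_cinner[symmetric] inner_diff_right)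
      (metis inner_eq_Re_cinner diff_self)
  from this[of "x - y"] show ?thesis by simp
qed

text \<open>The representing vector is the minimiser of \<open>J\<close>, the limit of a minimising sequence.\<close>

lemma riesz_representation_real:
  fixes f :: "'h::{real_inner,complete_space} \<Rightarrow> real"
  assumes "bounded_linear f"
  obtains z where "\<And>x. f x = x \<bullet> z"
proof -
  interpret f: bounded_linear f by fact
  define J where "J v = v \<bullet> v - 2 * f v" for v
  obtain K where K: "\<And>x. norm (f x) \<le> norm x * K" using f.bounded by blast
  \<comment> \<open>Completing the square in norm v, after f v \<le> K norm v.\<close>
  have low: "- K\<^sup>2 \<le> J v" for v
  proof -
    have "0 \<le> (norm v - K)\<^sup>2" by simp
    moreover have "f v \<le> norm v * K" using K[of v] by simp
    ultimately show ?thesis by (simp add: J_def power2_norm_eq_inner[symmetric] power2_eq_square algebra_simps)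
  qed
  then have bdd: "bdd_below (range J)" by (auto simp: bdd_below_def)
  define d where "d = Inf (range J)"
  have d: "d \<le> J v" for v unfolding d_def using bdd by (intro cInf_lower) auto
  have "\<exists>v. J v < d + 1 / real (Suc n)" for n
    using cInf_lessD[of "range J" "d + 1 / real (Suc n)"] by (auto simp: d_def)
  then obtain V where V: "\<And>n. J (V n) < d + 1 / real (Suc n)" by metis
  \<comment> \<open>By the parallelogram law, two near-minimizers are close, because their midpoint
    cannot go below d. This makes every minimizing sequence Cauchy.\<close>
  have par: "(norm (v - w))\<^sup>2 \<le> 2 * (J v - d) + 2 * (J w - d)" for v w
  proof -
    define m where "m = (1 / 2) *\<^sub>R (v + w)"
    have "(norm (v - w))\<^sup>2 = 2 * J v + 2 * J w - 4 * J m"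
      by (simp add: m_def J_def power2_norm_eq_inner f.add f.scaleR inner_add_left inner_add_right
          inner_diff_left inner_diff_right inner_commute field_simps)
    then show ?thesis using d[of m] by argo
  qed
  have "Cauchy V"
  proof (rule metric_CauchyI)
    fix e :: real assume e: "e > 0"
    obtain N where N: "1 / real (Suc N) < e\<^sup>2 / 4"
      using e nat_approx_posE[of "e\<^sup>2 / 4"] by (metis divide_pos_pos zero_less_numeral zero_less_power)
    show "\<exists>N. \<forall>m\<ge>N. \<forall>n\<ge>N. dist (V m) (V n) < e"
    proof (intro exI[of _ N] allI impI)
      fix m n assume mn: "m \<ge> N" "n \<ge> N"
      have s: "1 / real (Suc k) \<le> 1 / real (Suc N)" if "k \<ge> N" for k
        using that by (intro divide_left_mono) auto
      have "(norm (V m - V n))\<^sup>2 < e\<^sup>2"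
        using par[of "V m" "V n"] V[of m] V[of n] s[OF mn(1)] s[OF mn(2)] N by argo
      then show "dist (V m) (V n) < e"
        using e by (simp add: dist_norm power_less_imp_less_base)
    qed
  qed
  then obtain z where z: "V \<longlonglongrightarrow> z" by (metis Cauchy_convergent convergent_def)
  have "(\<lambda>n. J (V n)) \<longlonglongrightarrow> J z"
    unfolding J_def by (intro tendsto_intros f.tendsto z)
  moreover have "(\<lambda>n. d + 1 / real (Suc n)) \<longlonglongrightarrow> d + 0"
    by (intro tendsto_intros LIMSEQ_Suc[OF lim_1_over_n])
  ultimately have Jz: "J z \<le> d"
    using V by (intro LIMSEQ_le[of "\<lambda>n. J (V n)" _ "\<lambda>n. d + 1 / real (Suc n)"]) (auto intro: less_imp_le)
  have "f x = x \<bullet> z" for x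
  proof -
    define b where "b = x \<bullet> z - f x"
    have q: "0 \<le> 2 * t * b + t\<^sup>2 * (x \<bullet> x)" for t
    proof -
      have "J z \<le> J (z + t *\<^sub>R x)" using Jz d order_trans by blast
      then show ?thesis
        by (simp add: J_def b_def f.add f.scaleR inner_add_left inner_add_right inner_commute
            power2_eq_square algebra_simps)
    qed
    have "b = 0"
    proof (cases "x = 0")
      case False
      then have p: "x \<bullet> x > 0" by simp
      \<comment> \<open>The vertex of the parabola in t, where nonnegativity forces the linear
        coefficient to vanish.\<close>
      from q[of "- b / (x \<bullet> x)"] p have "b\<^sup>2 \<le> 0" by (simp add: field_simps power2_eq_square)
      then show ?thesis by simp
    qed (simp add: b_def)
    then show ?thesis by (simp add: b_def)
  qed
  then show ?thesis by (rule that)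
qed

section \<open>Adjoints of complex-linear operators\<close>

lemma complex_operatorsD: "x \<in> complex_operators \<Longrightarrow> blinfun_apply x (c *\<^sub>C \<xi>) = c *\<^sub>C blinfun_apply x \<xi>"
  by (simp add: complex_operators_def)

lemma adjoint_unique:
  assumes "\<And>\<xi> \<eta>. cinner (blinfun_apply x \<xi>) \<eta> = cinner \<xi> (blinfun_apply y \<eta>)"
    and "\<And>\<xi> \<eta>. cinner (blinfun_apply x \<xi>) \<eta> = cinner \<xi> (blinfun_apply z \<eta>)"
  shows "y = z"
  by (rule blinfun_eqI, rule cinner_eqI) (simp add: assms[symmetric])

lemma op_adjoint_eqI:
  assumes "\<And>\<xi> \<eta>. cinner (blinfun_apply x \<xi>) \<eta> = cinner \<xi> (blinfun_apply y \<eta>)"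
  shows "op_adjoint x = y"
  unfolding op_adjoint_def
proof (rule the_equality)
  show "z = y" if "\<forall>\<xi> \<eta>. cinner (blinfun_apply x \<xi>) \<eta> = cinner \<xi> (blinfun_apply z \<eta>)" for z
    using that assms by (intro adjoint_unique[of x]) auto
qed (use assms in auto)

text \<open>The Riesz theorem gives the adjoint for the real inner product; complex linearity of x
  and \<open>Im_cinner\<close> upgrade the identity to \<open>cinner\<close>. Existence is what
  gives the description in \<open>op_adjoint\<close> a meaning.\<close>

lemma adjoint_exists:
  fixes x :: "'h::complex_hilbert \<Rightarrow>\<^sub>L 'h"
  assumes x: "x \<in> complex_operators"
  obtains y where "\<And>\<xi> \<eta>. cinner (blinfun_apply x \<xi>) \<eta> = cinner \<xi> (blinfun_apply y \<eta>)"
proof -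
  have "\<exists>z. \<forall>\<xi>. blinfun_apply x \<xi> \<bullet> \<eta> = \<xi> \<bullet> z" for \<eta>
  proof -
    have "bounded_linear (\<lambda>\<xi>. blinfun_apply x \<xi> \<bullet> \<eta>)"
      by (intro bounded_linear_compose[OF bounded_linear_inner_left] blinfun.bounded_linear_right)
    then show ?thesis using riesz_representation_real by metis
  qed
  then obtain f where f: "\<And>\<eta> \<xi>. blinfun_apply x \<xi> \<bullet> \<eta> = \<xi> \<bullet> f \<eta>" by metis
  have c: "cinner (blinfun_apply x \<xi>) \<eta> = cinner \<xi> (f \<eta>)" for \<xi> \<eta>
    by (rule complex_eqI)
       (simp_all add: inner_eq_Re_cinner[symmetric] f Im_cinner complex_operatorsD[OF x, symmetric])
  have "bounded_linear f"
  proof (rule bounded_linear_intro[where K = "norm x"])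
    show "f (\<eta> + \<eta>') = f \<eta> + f \<eta>'" for \<eta> \<eta>'
      by (rule cinner_eqI) (simp add: c[symmetric] cinner_add_right)
    show "f (r *\<^sub>R \<eta>) = r *\<^sub>R f \<eta>" for r \<eta>
      by (rule cinner_eqI) (simp add: c[symmetric] cinner_scaleC_right scaleR_scaleC)
    show "norm (f \<eta>) \<le> norm \<eta> * norm x" for \<eta>
    proof -
      have "norm (f \<eta>) * norm (f \<eta>) = blinfun_apply x (f \<eta>) \<bullet> \<eta>"
        by (simp add: f power2_norm_eq_inner[symmetric] power2_eq_square)
      also have "\<dots> \<le> norm (blinfun_apply x (f \<eta>)) * norm \<eta>" by (rule norm_cauchy_schwarz)
      also have "\<dots> \<le> norm x * norm (f \<eta>) * norm \<eta>"
        by (intro mult_right_mono norm_blinfun) auto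
      finally have "norm (f \<eta>) * norm (f \<eta>) \<le> norm (f \<eta>) * (norm \<eta> * norm x)" by (simp add: mult_ac)
      then show ?thesis by (cases "f \<eta> = 0") auto
    qed
  qed
  then show ?thesis using c by (intro that[of "Blinfun f"]) (simp add: bounded_linear_Blinfun_apply)
qed

lemma cinner_op_adjoint:
  assumes "x \<in> complex_operators"
  shows "cinner (blinfun_apply x \<xi>) \<eta> = cinner \<xi> (blinfun_apply (op_adjoint x) \<eta>)"
proof -
  obtain y where y: "\<And>\<xi> \<eta>. cinner (blinfun_apply x \<xi>) \<eta> = cinner \<xi> (blinfun_apply y \<eta>)"
    using adjoint_exists[OF assms] by blast
  show ?thesis unfolding op_adjoint_eqI[OF y] by (rule y)
qed

lemma cinner_op_adjoint':
  assumes "x \<in> complex_operators"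
  shows "cinner (blinfun_apply (op_adjoint x) \<xi>) \<eta> = cinner \<xi> (blinfun_apply x \<eta>)"
proof -
  have "cnj (cinner (blinfun_apply x \<eta>) \<xi>) = cnj (cinner \<eta> (blinfun_apply (op_adjoint x) \<xi>))"
    by (simp only: cinner_op_adjoint[OF assms])
  then show ?thesis by (simp only: cinner_commute[symmetric])
qed

lemma op_adjoint_in_complex_operators:
  assumes "x \<in> complex_operators"
  shows "op_adjoint x \<in> complex_operators"
proof -
  have "blinfun_apply (op_adjoint x) (c *\<^sub>C \<xi>) = c *\<^sub>C blinfun_apply (op_adjoint x) \<xi>" for c \<xi>
    by (rule cinner_eqI) (simp only: cinner_op_adjoint[OF assms, symmetric] cinner_scaleC_right)
  then show ?thesis by (simp add: complex_operators_def)
qed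

lemma op_scaleC_apply [simp]: "blinfun_apply (op_scaleC c x) \<xi> = c *\<^sub>C blinfun_apply x \<xi>"
  unfolding op_scaleC_def
  by (subst bounded_linear_Blinfun_apply)
     (auto intro: bounded_linear_compose[OF bounded_linear_scaleC] blinfun.bounded_linear_right)

lemma complex_operators_add: "x \<in> complex_operators \<Longrightarrow> y \<in> complex_operators \<Longrightarrow> x + y \<in> complex_operators"
  by (simp add: complex_operators_def blinfun.add_left scaleC_add_right)

lemma complex_operators_comp: "x \<in> complex_operators \<Longrightarrow> y \<in> complex_operators \<Longrightarrow> x o\<^sub>L y \<in> complex_operators"
  by (simp add: complex_operators_def)

lemma complex_operators_scaleC: "x \<in> complex_operators \<Longrightarrow> op_scaleC c x \<in> complex_operators"
  by (simp add: complex_operators_def scaleC_scaleC mult.commute)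

lemma op_adjoint_add:
  assumes "x \<in> complex_operators" "y \<in> complex_operators"
  shows "op_adjoint (x + y) = op_adjoint x + op_adjoint y"
  by (rule op_adjoint_eqI)
     (simp add: blinfun.add_left cinner_add_left cinner_add_right cinner_op_adjoint assms)

lemma op_adjoint_scaleC:
  assumes "x \<in> complex_operators"
  shows "op_adjoint (op_scaleC c x) = op_scaleC (cnj c) (op_adjoint x)"
  by (rule op_adjoint_eqI)
     (simp add: cinner_scaleC_left cinner_scaleC_right cinner_op_adjoint assms)

lemma op_scaleC_comp_left: "op_scaleC c x o\<^sub>L y = op_scaleC c (x o\<^sub>L y)"
  by (rule blinfun_eqI) simp

lemma op_scaleC_comp_right: "x \<in> complex_operators \<Longrightarrow> x o\<^sub>L op_scaleC c y = op_scaleC c (x o\<^sub>L y)"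
  by (rule blinfun_eqI) (simp add: complex_operatorsD)


section \<open>The weak-* topology\<close>

lemma summable_cinner:
  fixes \<xi> \<eta> :: "nat \<Rightarrow> 'h::complex_hilbert"
  assumes "summable (\<lambda>k. (norm (\<xi> k))\<^sup>2)" "summable (\<lambda>k. (norm (\<eta> k))\<^sup>2)"
  shows "summable (\<lambda>k. cinner (blinfun_apply x (\<xi> k)) (\<eta> k))"
proof (rule summable_comparison_test')
  show "summable (\<lambda>k. norm x * ((norm (\<xi> k))\<^sup>2 + (norm (\<eta> k))\<^sup>2))"
    by (intro summable_mult summable_add assms)
  show "norm (cinner (blinfun_apply x (\<xi> k)) (\<eta> k)) \<le> norm x * ((norm (\<xi> k))\<^sup>2 + (norm (\<eta> k))\<^sup>2)" for k
  proof -
    have "norm (cinner (blinfun_apply x (\<xi> k)) (\<eta> k)) \<le> norm x * norm (\<xi> k) * norm (\<eta> k)"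
      by (rule order_trans[OF cmod_cinner_le]) (auto intro!: mult_right_mono norm_blinfun)
    also have "\<dots> \<le> norm x * ((norm (\<xi> k))\<^sup>2 + (norm (\<eta> k))\<^sup>2)"
      unfolding mult.assoc
    proof (rule mult_left_mono)
      have "0 \<le> (norm (\<xi> k) - norm (\<eta> k))\<^sup>2" "0 \<le> norm (\<xi> k) * norm (\<eta> k)" by simp_all
      then show "norm (\<xi> k) * norm (\<eta> k) \<le> (norm (\<xi> k))\<^sup>2 + (norm (\<eta> k))\<^sup>2"
        unfolding power2_diff by linarith
    qed simp
    finally show ?thesis .
  qed
qed

text \<open>Lets a bounded operator be absorbed into the vectors of a normal functional, so that
  composition with it yields a normal functional again.\<close>

lemma summable_norm_blinfun:
  assumes "summable (\<lambda>k. (norm (\<xi> k))\<^sup>2)"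
  shows "summable (\<lambda>k. (norm (blinfun_apply x (\<xi> k)))\<^sup>2)"
proof (rule summable_comparison_test')
  show "summable (\<lambda>k. (norm x)\<^sup>2 * (norm (\<xi> k))\<^sup>2)" by (intro summable_mult assms)
  show "norm ((norm (blinfun_apply x (\<xi> k)))\<^sup>2) \<le> (norm x)\<^sup>2 * (norm (\<xi> k))\<^sup>2" for k
    by (simp add: power_mult_distrib[symmetric] norm_blinfun power_mono)
qed

lemma normal_functionalsI:
  assumes "summable (\<lambda>k. (norm (\<xi> k))\<^sup>2)" "summable (\<lambda>k. (norm (\<eta> k))\<^sup>2)"
  shows "(\<lambda>x. \<Sum>k. cinner (blinfun_apply x (\<xi> k)) (\<eta> k)) \<in> normal_functionals"
  unfolding normal_functionals_def using assms by blast

lemma normal_functionalsE: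
  assumes "\<phi> \<in> normal_functionals"
  obtains \<xi> \<eta> where "summable (\<lambda>k. (norm (\<xi> k))\<^sup>2)" "summable (\<lambda>k. (norm (\<eta> k))\<^sup>2)"
    "\<phi> = (\<lambda>x. \<Sum>k. cinner (blinfun_apply x (\<xi> k)) (\<eta> k))"
  using assms unfolding normal_functionals_def by blast

text \<open>The zero functional with V = UNIV already contributes all complex-linear operators as a
  subbasic set.\<close>

lemma topspace_weak_star [simp]:
  "topspace (weak_star_topology :: ('h::complex_hilbert \<Rightarrow>\<^sub>L 'h) topology) = complex_operators"
proof -
  have "(\<lambda>x. \<Sum>k. cinner (blinfun_apply x (0 :: 'h)) 0) \<in> normal_functionals"
    by (rule normal_functionalsI) auto
  then have "\<exists>\<phi> :: ('h \<Rightarrow>\<^sub>L 'h) \<Rightarrow> complex. \<phi> \<in> normal_functionals" by blast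
  then show ?thesis
    unfolding weak_star_topology_def topology_generated_by_topspace by (auto intro!: exI[of _ UNIV])
qed

text \<open>It suffices to pull back subbasic sets. Besides the functional, the open set may change
  too, which accommodates conjugation in the adjoint and translation in the sum.\<close>

lemma continuous_map_weak_star:
  fixes f :: "('h::complex_hilbert \<Rightarrow>\<^sub>L 'h) \<Rightarrow> ('h \<Rightarrow>\<^sub>L 'h)"
  assumes f: "\<And>x. x \<in> complex_operators \<Longrightarrow> f x \<in> complex_operators"
    and \<phi>: "\<And>\<phi> V. \<phi> \<in> normal_functionals \<Longrightarrow> open V \<Longrightarrow>
       \<exists>\<psi>\<in>normal_functionals. \<exists>W. open W \<and> (\<forall>x\<in>complex_operators. \<phi> (f x) \<in> V \<longleftrightarrow> \<psi> x \<in> W)"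
  shows "continuous_map weak_star_topology weak_star_topology f"
proof -
  have "continuous_map weak_star_topology (topology_generated_by
     {{x \<in> complex_operators. \<phi> x \<in> V} | \<phi> V. \<phi> \<in> normal_functionals \<and> open V}) f"
  proof (rule continuous_on_generated_topo)
    fix A assume "A \<in> {{x \<in> complex_operators :: ('h \<Rightarrow>\<^sub>L 'h) set. \<phi> x \<in> V} | \<phi> V. \<phi> \<in> normal_functionals \<and> open V}"
    then obtain \<phi> V where A: "A = {x \<in> complex_operators. \<phi> x \<in> V}" "\<phi> \<in> normal_functionals" "open V" by blast
    from \<phi>[OF A(2,3)] obtain \<psi> W where W: "\<psi> \<in> normal_functionals" "open W"
      "\<forall>x\<in>complex_operators. \<phi> (f x) \<in> V \<longleftrightarrow> \<psi> x \<in> W" by blast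
    have "f -` A \<inter> topspace weak_star_topology = {x \<in> complex_operators. \<psi> x \<in> W}"
      using W(3) f by (auto simp: A)
    also have "openin weak_star_topology \<dots>"
      unfolding weak_star_topology_def using W by (intro topology_generated_by_Basis) blast
    finally show "openin weak_star_topology (f -` A \<inter> topspace weak_star_topology)" .
  next
    have "\<Union>{{x \<in> complex_operators. \<phi> x \<in> V} | \<phi> V. \<phi> \<in> normal_functionals \<and> open V}
        = (complex_operators :: ('h \<Rightarrow>\<^sub>L 'h) set)"
      using topspace_weak_star[where 'h = 'h]
      unfolding weak_star_topology_def topology_generated_by_topspace .
    then show "f ` topspace weak_star_topology
       \<subseteq> \<Union>{{x \<in> complex_operators. \<phi> x \<in> V} | \<phi> V. \<phi> \<in> normal_functionals \<and> open V}"
      using f by auto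
  qed
  then show ?thesis unfolding weak_star_topology_def .
qed

lemma weak_star_continuous_comp_right:
  assumes "y \<in> complex_operators"
  shows "continuous_map weak_star_topology weak_star_topology (\<lambda>x. x o\<^sub>L y)"
proof (rule continuous_map_weak_star)
  fix \<phi> :: "('a \<Rightarrow>\<^sub>L 'a) \<Rightarrow> complex" and V :: "complex set" assume "\<phi> \<in> normal_functionals" and V: "open V"
  then obtain \<xi> \<eta> where *: "summable (\<lambda>k. (norm (\<xi> k))\<^sup>2)" "summable (\<lambda>k. (norm (\<eta> k))\<^sup>2)"
    "\<phi> = (\<lambda>x. \<Sum>k. cinner (blinfun_apply x (\<xi> k)) (\<eta> k))" by (elim normal_functionalsE)
  show "\<exists>\<psi>\<in>normal_functionals. \<exists>W. open W \<and> (\<forall>x\<in>complex_operators. \<phi> (x o\<^sub>L y) \<in> V \<longleftrightarrow> \<psi> x \<in> W)"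
    by (rule bexI[OF _ normal_functionalsI[OF summable_norm_blinfun[OF *(1), of y] *(2)]])
       (auto simp: * V intro!: exI[of _ V])
qed (simp add: complex_operators_comp assms)

text \<open>The fixed left factor passes to the second family of vectors as its adjoint; a right
  factor is simply applied to the first family.\<close>

lemma weak_star_continuous_comp_left:
  assumes "y \<in> complex_operators"
  shows "continuous_map weak_star_topology weak_star_topology (\<lambda>x. y o\<^sub>L x)"
proof (rule continuous_map_weak_star)
  fix \<phi> :: "('a \<Rightarrow>\<^sub>L 'a) \<Rightarrow> complex" and V :: "complex set" assume "\<phi> \<in> normal_functionals" and V: "open V"
  then obtain \<xi> \<eta> where *: "summable (\<lambda>k. (norm (\<xi> k))\<^sup>2)" "summable (\<lambda>k. (norm (\<eta> k))\<^sup>2)"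
    "\<phi> = (\<lambda>x. \<Sum>k. cinner (blinfun_apply x (\<xi> k)) (\<eta> k))" by (elim normal_functionalsE)
  show "\<exists>\<psi>\<in>normal_functionals. \<exists>W. open W \<and> (\<forall>x\<in>complex_operators. \<phi> (y o\<^sub>L x) \<in> V \<longleftrightarrow> \<psi> x \<in> W)"
    by (rule bexI[OF _ normal_functionalsI[OF *(1) summable_norm_blinfun[OF *(2), of "op_adjoint y"]]])
       (auto simp: * V cinner_op_adjoint[OF assms] intro!: exI[of _ V])
qed (simp add: complex_operators_comp assms)

lemma weak_star_continuous_scaleC:
  "continuous_map weak_star_topology weak_star_topology (op_scaleC c)"
proof (rule continuous_map_weak_star)
  fix \<phi> :: "('a \<Rightarrow>\<^sub>L 'a) \<Rightarrow> complex" and V :: "complex set" assume "\<phi> \<in> normal_functionals" and V: "open V"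
  then obtain \<xi> \<eta> where *: "summable (\<lambda>k. (norm (\<xi> k))\<^sup>2)" "summable (\<lambda>k. (norm (\<eta> k))\<^sup>2)"
    "\<phi> = (\<lambda>x. \<Sum>k. cinner (blinfun_apply x (\<xi> k)) (\<eta> k))" by (elim normal_functionalsE)
  have "summable (\<lambda>k. (norm (c *\<^sub>C \<xi> k))\<^sup>2)"
    by (simp add: norm_scaleC_hilbert power_mult_distrib summable_mult *(1))
  from normal_functionalsI[OF this *(2)]
  show "\<exists>\<psi>\<in>normal_functionals. \<exists>W. open W \<and> (\<forall>x\<in>complex_operators. \<phi> (op_scaleC c x) \<in> V \<longleftrightarrow> \<psi> x \<in> W)"
    by (rule bexI[rotated]) (auto simp: * V complex_operatorsD intro!: exI[of _ V])
qed (rule complex_operators_scaleC)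

text \<open>Exchanging the two families of vectors turns the value at the adjoint into a complex
  conjugate, so V is replaced by its conjugate set.\<close>

lemma weak_star_continuous_adjoint:
  "continuous_map weak_star_topology weak_star_topology op_adjoint"
proof (rule continuous_map_weak_star)
  fix \<phi> :: "('a \<Rightarrow>\<^sub>L 'a) \<Rightarrow> complex" and V :: "complex set" assume "\<phi> \<in> normal_functionals" and V: "open V"
  then obtain \<xi> \<eta> where *: "summable (\<lambda>k. (norm (\<xi> k))\<^sup>2)" "summable (\<lambda>k. (norm (\<eta> k))\<^sup>2)"
    "\<phi> = (\<lambda>x. \<Sum>k. cinner (blinfun_apply x (\<xi> k)) (\<eta> k))" by (elim normal_functionalsE)
  have "\<phi> (op_adjoint x) = cnj (\<Sum>k. cinner (blinfun_apply x (\<eta> k)) (\<xi> k))" if x: "x \<in> complex_operators" for x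
  proof -
    have "\<phi> (op_adjoint x) = (\<Sum>k. cnj (cinner (blinfun_apply x (\<eta> k)) (\<xi> k)))"
      by (simp add: * cinner_op_adjoint'[OF x] cinner_commute[symmetric])
    also have "\<dots> = cnj (\<Sum>k. cinner (blinfun_apply x (\<eta> k)) (\<xi> k))"
      using bounded_linear.suminf[OF bounded_linear_cnj summable_cinner[OF *(2,1)], of x] by simp
    finally show ?thesis .
  qed
  moreover have "open (cnj -` V)"
    using V by (intro open_vimage continuous_intros)
  ultimately show "\<exists>\<psi>\<in>normal_functionals. \<exists>W. open W \<and> (\<forall>x\<in>complex_operators. \<phi> (op_adjoint x) \<in> V \<longleftrightarrow> \<psi> x \<in> W)"
    by (intro bexI[OF _ normal_functionalsI[OF *(2,1)]] exI[of _ "cnj -` V"]) auto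
qed (rule op_adjoint_in_complex_operators)

lemma weak_star_continuous_add:
  assumes "y \<in> complex_operators"
  shows "continuous_map weak_star_topology weak_star_topology (\<lambda>x. x + y)"
proof (rule continuous_map_weak_star)
  fix \<phi> :: "('a \<Rightarrow>\<^sub>L 'a) \<Rightarrow> complex" and V :: "complex set" assume phi: "\<phi> \<in> normal_functionals" and V: "open V"
  then obtain \<xi> \<eta> where *: "summable (\<lambda>k. (norm (\<xi> k))\<^sup>2)" "summable (\<lambda>k. (norm (\<eta> k))\<^sup>2)"
    "\<phi> = (\<lambda>x. \<Sum>k. cinner (blinfun_apply x (\<xi> k)) (\<eta> k))" by (elim normal_functionalsE)
  have "\<phi> (x + y) = \<phi> x + \<phi> y" for x
    by (simp add: * blinfun.add_left cinner_add_left suminf_add[OF summable_cinner summable_cinner])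
  moreover have "open ((\<lambda>z. z + \<phi> y) -` V)"
    using V by (intro open_vimage continuous_intros)
  ultimately show "\<exists>\<psi>\<in>normal_functionals. \<exists>W. open W \<and> (\<forall>x\<in>complex_operators. \<phi> (x + y) \<in> V \<longleftrightarrow> \<psi> x \<in> W)"
    using phi by (intro bexI[of _ \<phi>] exI[of _ "(\<lambda>z. z + \<phi> y) -` V"]) auto
qed (simp add: complex_operators_add assms)

text \<open>Images of S need only land in the closure of S. This is what permits a second pass,
  where the other operand of a sum or product is already a limit.\<close>

lemma closure_of_invariant:
  assumes "continuous_map X X f" "f ` S \<subseteq> X closure_of S" "x \<in> X closure_of S"
  shows "f x \<in> X closure_of S"
proof -
  have "f x \<in> X closure_of (f ` S)"
    using continuous_map_image_closure_subset[OF assms(1), of S] assms(3) by auto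
  also have "\<dots> \<subseteq> X closure_of (X closure_of S)" using assms(2) by (rule closure_of_mono)
  finally show ?thesis by simp
qed


section \<open>The algebra as a subspace of $L_2$\<close>

locale nc_torus_L2 =
  fixes \<pi> :: "'a::cstar_algebra \<Rightarrow> ('h::complex_hilbert \<Rightarrow>\<^sub>L 'h)"
    and \<tau>\<^sub>M :: "('h \<Rightarrow>\<^sub>L 'h) \<Rightarrow> complex"
    and \<iota> :: "('h \<Rightarrow>\<^sub>L 'h) \<Rightarrow> 'l::complex_hilbert"
  assumes rep: "star_representation \<pi>"
    and trace: "normal_faithful_tracial_state (nc_torus \<pi>) \<tau>\<^sub>M"
    and L2: "nc_L2_space (nc_torus \<pi>) \<tau>\<^sub>M \<iota>"
begin

abbreviation M where "M \<equiv> nc_torus \<pi>"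

lemma M_eq: "M = weak_star_topology closure_of (range \<pi>)" by (simp add: nc_torus_def)

lemma M_complex: "x \<in> M \<Longrightarrow> x \<in> complex_operators"
  using closure_of_subset_topspace[of weak_star_topology "range \<pi>"] by (auto simp: M_eq)

lemma range_M: "\<pi> a \<in> M"
  using rep closure_of_subset[of "range \<pi>" weak_star_topology]
  by (auto simp: M_eq star_representation_def)

lemma pi_simps:
  "\<pi> (a + b) = \<pi> a + \<pi> b" "\<pi> (a * b) = \<pi> a o\<^sub>L \<pi> b" "\<pi> (c *\<^sub>C a) = op_scaleC c (\<pi> a)"
  "\<pi> (star a) = op_adjoint (\<pi> a)" "\<pi> 1 = id_blinfun"
  using rep by (auto simp: star_representation_def)

lemma M_invariant:
  assumes "continuous_map weak_star_topology weak_star_topology f" "\<And>a. f (\<pi> a) \<in> M" "x \<in> M"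
  shows "f x \<in> M"
  using closure_of_invariant[OF assms(1), of "range \<pi>" x] assms(2,3) by (auto simp: M_eq)

lemma M_scaleC: "x \<in> M \<Longrightarrow> op_scaleC c x \<in> M"
  by (rule M_invariant[OF weak_star_continuous_scaleC]) (auto simp: pi_simps[symmetric] range_M)

lemma M_adjoint: "x \<in> M \<Longrightarrow> op_adjoint x \<in> M"
  by (rule M_invariant[OF weak_star_continuous_adjoint]) (auto simp: pi_simps[symmetric] range_M)

text \<open>Continuity is available for translation by a fixed operator, so the closure is taken
  twice: first with a summand from the range of \<pi>, then with an arbitrary y in
  \<open>M\<close>.\<close>

lemma M_add:
  assumes "x \<in> M" "y \<in> M"
  shows "x + y \<in> M"
proof -
  have 1: "z + \<pi> a \<in> M" if "z \<in> M" for z a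
    using that
    by (rule M_invariant[OF weak_star_continuous_add[OF M_complex[OF range_M]], rotated])
       (auto simp: pi_simps[symmetric] range_M)
  show ?thesis
    using assms(1)
  proof (rule M_invariant[OF weak_star_continuous_add[OF M_complex[OF assms(2)]], rotated])
    show "\<pi> a + y \<in> M" for a using 1[OF assms(2), of a] by (simp add: add.commute)
  qed
qed

lemma M_comp:
  assumes "x \<in> M" "y \<in> M"
  shows "x o\<^sub>L y \<in> M"
proof -
  \<comment> \<open>Multiplication is only separately continuous, so the closure is taken in one factor at a time.\<close>
  have 1: "z o\<^sub>L \<pi> a \<in> M" if "z \<in> M" for z a
    using that
    by (rule M_invariant[OF weak_star_continuous_comp_right[OF M_complex[OF range_M]], rotated])
       (auto simp: pi_simps[symmetric] range_M)
  show ?thesis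
    using assms(2)
    by (rule M_invariant[OF weak_star_continuous_comp_left[OF M_complex[OF assms(1)]], rotated])
       (rule 1[OF assms(1)])
qed

lemma trace_add: "x \<in> M \<Longrightarrow> y \<in> M \<Longrightarrow> \<tau>\<^sub>M (x + y) = \<tau>\<^sub>M x + \<tau>\<^sub>M y"
  and trace_scaleC: "x \<in> M \<Longrightarrow> \<tau>\<^sub>M (op_scaleC c x) = c * \<tau>\<^sub>M x"
  and trace_nonneg: "x \<in> M \<Longrightarrow> \<tau>\<^sub>M (op_adjoint x o\<^sub>L x) \<in> \<real>\<^sub>\<ge>\<^sub>0"
  and trace_commute: "x \<in> M \<Longrightarrow> y \<in> M \<Longrightarrow> \<tau>\<^sub>M (x o\<^sub>L y) = \<tau>\<^sub>M (y o\<^sub>L x)"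
  using trace by (auto simp: normal_faithful_tracial_state_def)

lemma iota_add: "x \<in> M \<Longrightarrow> y \<in> M \<Longrightarrow> \<iota> (x + y) = \<iota> x + \<iota> y"
  and iota_scaleC: "x \<in> M \<Longrightarrow> \<iota> (op_scaleC c x) = c *\<^sub>C \<iota> x"
  and norm_iota: "x \<in> M \<Longrightarrow> norm (\<iota> x) = sqrt (Re (\<tau>\<^sub>M (op_adjoint x o\<^sub>L x)))"
  and dense_iota: "closure (\<iota> ` M) = UNIV"
  using L2 by (auto simp: nc_L2_space_def)

text \<open>Positivity of the trace makes \<open>B\<close> hermitian, so polarizing the norm formula suffices.\<close>

lemma cinner_iota:
  assumes y: "y \<in> M" and z: "z \<in> M"
  shows "cinner (\<iota> y) (\<iota> z) = \<tau>\<^sub>M (op_adjoint z o\<^sub>L y)"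
proof -
  define B where "B y z = \<tau>\<^sub>M (op_adjoint z o\<^sub>L y)" for y z
  have Badd: "B (x + y) (x + y) = B x x + B x y + B y x + B y y" if "x \<in> M" "y \<in> M" for x y
    using that
    by (simp add: B_def op_adjoint_add M_complex trace_add M_add M_comp M_adjoint
        bounded_bilinear.add_left[OF bounded_bilinear_blinfun_compose]
        bounded_bilinear.add_right[OF bounded_bilinear_blinfun_compose])
  have B1: "B (op_scaleC c x) y = c * B x y" and B2: "B x (op_scaleC c y) = cnj c * B x y"
    if "x \<in> M" "y \<in> M" for x y c
    using that
    by (simp_all add: B_def op_adjoint_scaleC op_scaleC_comp_left op_scaleC_comp_right M_complex
        M_adjoint trace_scaleC M_comp)
  have Bn: "Im (B x x) = 0" "Re (B x x) = (norm (\<iota> x))\<^sup>2" if "x \<in> M" for x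
    using trace_nonneg[OF that] norm_iota[OF that]
    by (auto simp: B_def complex_nonneg_Reals_iff)
  \<comment> \<open>The values of \<open>B\<close> at (x,x), (y,y) and (x+y,x+y) are real, so the
    imaginary parts of the two cross terms cancel. Replacing y by \<i> y gives the symmetry of the
    real parts.\<close>
  have Im: "Im (B x y) = - Im (B y x)" if "x \<in> M" "y \<in> M" for x y
    using Bn(1)[OF M_add[OF that]] Bn(1) that by (simp add: Badd)
  have Re_sym: "Re (B x y) = Re (B y x)" if "x \<in> M" "y \<in> M" for x y
    using Im[OF that(1) M_scaleC[OF that(2)], of \<i>] that by (simp add: B1 B2)
  have Re: "\<iota> x \<bullet> \<iota> y = Re (B x y)" if "x \<in> M" "y \<in> M" for x y
  proof -
    have "(norm (\<iota> x + \<iota> y))\<^sup>2 = Re (B (x + y) (x + y))"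
      using that by (simp add: Bn M_add iota_add)
    also have "\<dots> = (norm (\<iota> x))\<^sup>2 + 2 * Re (B x y) + (norm (\<iota> y))\<^sup>2"
      using that by (simp add: Badd Bn Re_sym[of y x])
    finally show ?thesis
      by (simp add: power2_norm_eq_inner inner_add_left inner_add_right inner_commute)
  qed
  have "cinner (\<iota> y) (\<iota> z) = B y z"
  proof (rule complex_eqI)
    show "Re (cinner (\<iota> y) (\<iota> z)) = Re (B y z)"
      by (simp add: inner_eq_Re_cinner[symmetric] Re y z)
    show "Im (cinner (\<iota> y) (\<iota> z)) = Im (B y z)"
      using Re[OF M_scaleC[OF y] z, of \<i>] by (simp add: Im_cinner iota_scaleC B1 y z)
  qed
  then show ?thesis by (simp add: B_def)
qed

text \<open>On the image of \<open>M\<close> both sides agree by \<open>cinner_iota\<close> and the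
  trace property, and the inner product is continuous on the whole space. The limit is thus the
  inner product at x.\<close>

lemma fourier_coeff_eq_cinner:
  assumes e: "e \<in> M"
  shows "fourier_coeff M \<tau>\<^sub>M \<iota> e x = cinner x (\<iota> e)"
  unfolding fourier_coeff_def
proof (rule tendsto_Lim)
  let ?F = "inf (filtercomap \<iota> (nhds x)) (principal M)"
  \<comment> \<open>\<open>Lim\<close> is determined only along a proper filter; density of the
    image of \<open>M\<close> ensures that.\<close>
  show "?F \<noteq> bot"
  proof
    assume "?F = bot"
    then have "eventually (\<lambda>_. False) ?F" by simp
    then obtain P where P: "eventually P (nhds x)" "\<And>y. P (\<iota> y) \<Longrightarrow> y \<notin> M"
      by (auto simp: eventually_inf_principal eventually_filtercomap)
    then obtain T where T: "open T" "x \<in> T" "\<And>y. y \<in> T \<Longrightarrow> P y"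
      by (auto simp: eventually_nhds)
    have "x \<in> closure (\<iota> ` M)" using dense_iota by simp
    then have "T \<inter> \<iota> ` M \<noteq> {}"
      using T(1,2) by (metis IntI empty_iff open_Int_closure_eq_empty)
    then show False using T(3) P(2) by blast
  qed
  have "filterlim \<iota> (nhds x) ?F"
    by (rule filterlim_mono[OF filterlim_filtercomap order_refl inf_le1])
  then have "((\<lambda>y. cinner (\<iota> y) (\<iota> e)) \<longlongrightarrow> cinner x (\<iota> e)) ?F"
    by (rule bounded_linear.tendsto[OF bounded_linear_cinner_left])
  moreover have "\<forall>\<^sub>F y in ?F. cinner (\<iota> y) (\<iota> e) = \<tau>\<^sub>M (y o\<^sub>L op_adjoint e)"
    by (auto simp: eventually_inf_principal cinner_iota e trace_commute M_adjoint)
  ultimately show "((\<lambda>y. \<tau>\<^sub>M (y o\<^sub>L op_adjoint e)) \<longlongrightarrow> cinner x (\<iota> e)) ?F"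
    by (rule Lim_transform_eventually)
qed

end


section \<open>Monomials\<close>

lemma scaleC_one [simp]: "1 *\<^sub>C (x :: 'a::complex_space) = x"
  using scaleR_scaleC[of 1 x] by simp

section \<open>Commutation up to a scalar\<close>

text \<open>The scalar is left unspecified because the trace of a monomial of nonzero degree
  vanishes whatever its coefficient. As c may be 0, the relation is not symmetric by
  definition.\<close>

definition commute_upto_phase :: "'a::cstar_algebra \<Rightarrow> 'a \<Rightarrow> bool" where
  "commute_upto_phase x y \<longleftrightarrow> (\<exists>c. x * y = c *\<^sub>C (y * x))"

lemma commute_upto_phase_1 [simp]: "commute_upto_phase x 1"
  unfolding commute_upto_phase_def by (intro exI[of _ 1]) simp

lemma commute_upto_phase_mult:
  assumes "commute_upto_phase x y" "commute_upto_phase x z"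
  shows "commute_upto_phase x (y * z)"
proof -
  obtain b c where b: "x * y = b *\<^sub>C (y * x)" and c: "x * z = c *\<^sub>C (z * x)"
    using assms by (auto simp: commute_upto_phase_def)
  have "x * (y * z) = (x * y) * z" by (simp add: mult.assoc)
  also have "\<dots> = b *\<^sub>C (y * (x * z))" by (simp add: b mult_scaleC_left mult.assoc)
  also have "\<dots> = (b * c) *\<^sub>C ((y * z) * x)" by (simp add: c mult_scaleC_right scaleC_scaleC mult.assoc)
  finally show ?thesis unfolding commute_upto_phase_def by blast
qed

lemma commute_upto_phase_power: "commute_upto_phase x y \<Longrightarrow> commute_upto_phase x (y ^ n)"
  by (induction n) (auto intro: commute_upto_phase_mult)

lemma commute_upto_phase_mult_left:
  assumes "commute_upto_phase y x" "commute_upto_phase z x"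
  shows "commute_upto_phase (y * z) x"
proof -
  obtain b c where b: "y * x = b *\<^sub>C (x * y)" and c: "z * x = c *\<^sub>C (x * z)"
    using assms by (auto simp: commute_upto_phase_def)
  have "(y * z) * x = c *\<^sub>C ((y * x) * z)" by (simp add: c mult_scaleC_right mult.assoc)
  also have "\<dots> = (c * b) *\<^sub>C (x * (y * z))" by (simp add: b mult_scaleC_left scaleC_scaleC mult.assoc)
  finally show ?thesis unfolding commute_upto_phase_def by blast
qed

lemma commute_upto_phase_1_left [simp]: "commute_upto_phase 1 x"
  unfolding commute_upto_phase_def by (intro exI[of _ 1]) simp

lemma commute_upto_phase_power_left: "commute_upto_phase y x \<Longrightarrow> commute_upto_phase (y ^ n) x"
  by (induction n) (auto intro: commute_upto_phase_mult_left)

lemma commute_upto_phase_prod_list: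
  "(\<And>y. y \<in> set ys \<Longrightarrow> commute_upto_phase y x) \<Longrightarrow> commute_upto_phase (prod_list ys) x"
  by (induction ys) (auto intro: commute_upto_phase_mult_left)

lemma star_one [simp]: "star (1 :: 'a::cstar_algebra) = 1"
  by (metis mult_1 mult_1_right star_mult star_star)

lemma star_power: "star (x ^ n) = star (x :: 'a::cstar_algebra) ^ n"
  by (induction n) (auto simp: star_mult power_commutes)

lemma commute_upto_phase_star_both:
  assumes "commute_upto_phase x y"
  shows "commute_upto_phase (star y) (star x)"
proof -
  obtain b where b: "x * y = b *\<^sub>C (y * x)" using assms by (auto simp: commute_upto_phase_def)
  from arg_cong[OF b, of star] show ?thesis
    unfolding commute_upto_phase_def by (auto simp: star_mult star_scaleC)
qed

text \<open>Multiplying y u = b u y by the adjoint of u on both sides cancels u and exchanges the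
  order.\<close>

lemma commute_upto_phase_star_left:
  assumes "unitary u" "commute_upto_phase y u"
  shows "commute_upto_phase (star u) y"
proof -
  obtain b where b: "y * u = b *\<^sub>C (u * y)" using assms by (auto simp: commute_upto_phase_def)
  have u: "star u * u = 1" "u * star u = 1" using assms by (auto simp: unitary_def)
  have "star u * y = star u * (y * u) * star u" by (simp add: mult.assoc u)
  also have "\<dots> = b *\<^sub>C ((star u * u) * (y * star u))"
    unfolding b by (simp add: mult_scaleC_left mult_scaleC_right mult.assoc)
  finally show ?thesis unfolding commute_upto_phase_def using u by auto
qed

section \<open>Integer powers of unitaries\<close>

lemma unitary_star: "unitary u \<Longrightarrow> unitary (star u)"
  by (auto simp: unitary_def star_star)

lemma unitary_mult:
  assumes "unitary u" "unitary v"
  shows "unitary (u * v)"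
proof -
  have "star (u * v) * (u * v) = star v * (star u * u) * v"
    "u * v * star (u * v) = u * (v * star v) * star u"
    by (simp_all add: star_mult mult.assoc)
  then show ?thesis using assms by (simp add: unitary_def)
qed

lemma unitary_one [simp]: "unitary 1" by (simp add: unitary_def)

lemma unitary_power_nat: "unitary u \<Longrightarrow> unitary (u ^ n)"
  by (induction n) (auto intro: unitary_mult)

lemma unitary_unitary_power: "unitary u \<Longrightarrow> unitary (unitary_power u m)"
  by (simp add: unitary_power_def unitary_power_nat unitary_star)

lemma unitary_prod_list: "(\<And>x. x \<in> set xs \<Longrightarrow> unitary x) \<Longrightarrow> unitary (prod_list xs)"
  by (induction xs) (auto intro: unitary_mult)

lemma star_unitary_power: "star (unitary_power u m) = unitary_power u (- m)"
  by (auto simp: unitary_power_def star_power star_star)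

lemma unitary_power_uminus: "unitary_power u (- int k) = star u ^ k"
  by (cases "k = 0") (auto simp: unitary_power_def)

lemma unitary_power_Suc:
  assumes "unitary u"
  shows "unitary_power u (m + 1) = u * unitary_power u m"
proof (cases "m \<ge> 0")
  case True
  then show ?thesis by (simp add: unitary_power_def nat_add_distrib)
next
  case False
  then obtain k where k: "m = - int (Suc k)" by (metis int_cases not_le of_nat_0_le_iff)
  have "u * (star u * x) = x" for x using assms by (simp add: mult.assoc[symmetric] unitary_def)
  then have "u * unitary_power u (- int (Suc k)) = unitary_power u (- int k)"
    unfolding unitary_power_uminus by simp
  then show ?thesis using k by simp
qed

text \<open>Induction on m in both directions from 0. The downward step proves the claim after
  multiplication by u and then cancels u, which is invertible.\<close>

lemma unitary_power_add:
  assumes "unitary u"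
  shows "unitary_power u (m + n) = unitary_power u m * unitary_power u n"
proof (induction m rule: int_induct[where k = 0])
  case base
  then show ?case by (simp add: unitary_power_def)
next
  case (step1 i)
  then show ?case
    using unitary_power_Suc[OF assms, of i] unitary_power_Suc[OF assms, of "i + n"]
    by (simp add: mult.assoc add_ac)
next
  case (step2 i)
  have "i - 1 + n + 1 = i + n" by simp
  then have "u * unitary_power u (i - 1 + n) = unitary_power u (i + n)"
    using unitary_power_Suc[OF assms, of "i - 1 + n"] by metis
  also have "\<dots> = u * unitary_power u (i - 1) * unitary_power u n"
    using unitary_power_Suc[OF assms, of "i - 1"] step2 by simp
  finally have "u * unitary_power u (i - 1 + n) = u * (unitary_power u (i - 1) * unitary_power u n)"
    by (simp only: mult.assoc)
  then have "star u * (u * unitary_power u (i - 1 + n)) = star u * (u * (unitary_power u (i - 1) * unitary_power u n))"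
    by simp
  then show ?case using assms by (simp add: mult.assoc[symmetric] unitary_def)
qed

lemma commute_upto_phase_star_right:
  assumes "unitary u" "commute_upto_phase u y"
  shows "commute_upto_phase y (star u)"
proof -
  obtain b where b: "u * y = b *\<^sub>C (y * u)" using assms by (auto simp: commute_upto_phase_def)
  have u: "star u * u = 1" "u * star u = 1" using assms by (auto simp: unitary_def)
  have "y * star u = star u * (u * y) * star u" by (simp add: mult.assoc[symmetric] u)
  also have "\<dots> = b *\<^sub>C ((star u * y) * (u * star u))"
    unfolding b by (simp add: mult_scaleC_left mult_scaleC_right mult.assoc)
  finally show ?thesis unfolding commute_upto_phase_def using u by auto
qed

text \<open>There are four cases for the signs of the exponents. Passing to an adjoint exchanges the
  order in the relation, hence the assumption in both orders.\<close>

lemma commute_upto_phase_unitary_power: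
  assumes "unitary u" "unitary v" "commute_upto_phase u v" "commute_upto_phase v u"
  shows "commute_upto_phase (unitary_power u m) (unitary_power v n)"
  using assms
  by (auto simp: unitary_power_def intro!: commute_upto_phase_power commute_upto_phase_power_left
      intro: commute_upto_phase_star_left commute_upto_phase_star_right commute_upto_phase_star_both)

section \<open>Products of powers of the generators\<close>

context
  fixes \<theta> :: "real ^ ('d::{finite,linorder}) ^ ('d::{finite,linorder})"
    and U :: "'d \<Rightarrow> 'a::cstar_algebra"
  assumes rel: "torus_relations \<theta> U"
begin

lemma unitary_generator: "unitary (U k)"
  using rel by (simp add: torus_relations_def)

lemma commute_upto_phase_generators:
  "commute_upto_phase (unitary_power (U j) m) (unitary_power (U k) n)"
proof (rule commute_upto_phase_unitary_power)
  show "commute_upto_phase (U j) (U k)" "commute_upto_phase (U k) (U j)"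
    using rel unfolding torus_relations_def commute_upto_phase_def by blast+
qed (rule unitary_generator)+

lemma commute_upto_phase_generators_list:
  "commute_upto_phase (prod_list (map (\<lambda>k. unitary_power (U k) (n k)) xs)) (unitary_power (U j) m)"
  by (rule commute_upto_phase_prod_list) (auto simp: commute_upto_phase_generators)

text \<open>The head factor of the second product is moved left past the tail of the first at the
  cost of a scalar, next to the power of the same generator, where the exponents add.\<close>

lemma prod_list_generators_mult:
  "\<exists>c. prod_list (map (\<lambda>k. unitary_power (U k) (n k)) xs) * prod_list (map (\<lambda>k. unitary_power (U k) (m k)) xs)
     = c *\<^sub>C prod_list (map (\<lambda>k. unitary_power (U k) (n k + m k)) xs)"
proof (induction xs)
  case Nil
  show ?case by (auto intro!: exI[of _ 1])
next
  case (Cons k xs)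
  let ?P = "\<lambda>f. prod_list (map (\<lambda>k. unitary_power (U k) (f k)) xs)"
  let ?a = "unitary_power (U k) (n k)" and ?b = "unitary_power (U k) (m k)"
  obtain c where c: "?P n * ?P m = c *\<^sub>C ?P (\<lambda>k. n k + m k)" using Cons by auto
  obtain d where d: "?P n * ?b = d *\<^sub>C (?b * ?P n)"
    using commute_upto_phase_generators_list[of n xs k "m k"] unfolding commute_upto_phase_def by blast
  have "(?a * ?P n) * (?b * ?P m) = ?a * (?P n * ?b) * ?P m" by (simp add: mult.assoc)
  also have "\<dots> = d *\<^sub>C (?a * ?b * (?P n * ?P m))"
    unfolding d by (simp add: mult_scaleC_left mult_scaleC_right mult.assoc)
  also have "\<dots> = (d * c) *\<^sub>C (unitary_power (U k) (n k + m k) * ?P (\<lambda>k. n k + m k))"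
    unfolding c by (simp add: mult_scaleC_right scaleC_scaleC unitary_power_add[OF unitary_generator])
  finally show ?case by auto
qed

text \<open>The adjoint reverses the factors; the induction brings the head factor back to the front
  at the cost of a scalar.\<close>

lemma prod_list_generators_star:
  "\<exists>c. star (prod_list (map (\<lambda>k. unitary_power (U k) (n k)) xs))
     = c *\<^sub>C prod_list (map (\<lambda>k. unitary_power (U k) (- n k)) xs)"
proof (induction xs)
  case Nil
  show ?case by (auto intro!: exI[of _ 1])
next
  case (Cons k xs)
  let ?P = "\<lambda>f. prod_list (map (\<lambda>k. unitary_power (U k) (f k)) xs)"
  let ?a = "unitary_power (U k) (- n k)"
  obtain c where c: "star (?P n) = c *\<^sub>C ?P (\<lambda>k. - n k)" using Cons by auto
  obtain d where d: "?P (\<lambda>k. - n k) * ?a = d *\<^sub>C (?a * ?P (\<lambda>k. - n k))"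
    using commute_upto_phase_generators_list[of "\<lambda>k. - n k" xs k "- n k"]
    unfolding commute_upto_phase_def by blast
  have "star (unitary_power (U k) (n k) * ?P n) = (c * d) *\<^sub>C (?a * ?P (\<lambda>k. - n k))"
    by (simp add: star_mult c star_unitary_power mult_scaleC_left d scaleC_scaleC)
  then show ?case by auto
qed

lemma star_monomial_mult:
  "\<exists>c. star (monomial U m) * monomial U n = c *\<^sub>C monomial U (n - m)"
proof -
  let ?P = "\<lambda>f. prod_list (map (\<lambda>k. unitary_power (U k) (f k)) (sorted_list_of_set UNIV))"
  obtain c where c: "star (?P (\<lambda>k. m $ k)) = c *\<^sub>C ?P (\<lambda>k. - m $ k)"
    using prod_list_generators_star by blast
  obtain d where d: "?P (\<lambda>k. - m $ k) * ?P (\<lambda>k. n $ k) = d *\<^sub>C ?P (\<lambda>k. - m $ k + n $ k)"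
    using prod_list_generators_mult[of "\<lambda>k. - m $ k" _ "\<lambda>k. n $ k"] by blast
  have "star (monomial U m) * monomial U n = (c * d) *\<^sub>C ?P (\<lambda>k. - m $ k + n $ k)"
    unfolding monomial_def by (simp only: c d mult_scaleC_left scaleC_scaleC)
  also have "?P (\<lambda>k. - m $ k + n $ k) = monomial U (n - m)"
    by (simp add: monomial_def add.commute)
  finally show ?thesis by blast
qed

lemma unitary_monomial: "unitary (monomial U n)"
  unfolding monomial_def
  by (rule unitary_prod_list) (auto intro: unitary_unitary_power unitary_generator)

text \<open>The diagonal value is exactly 1 by unitarity, so the unknown scalar matters only off the
  diagonal, where the trace is 0 in any case.\<close>

lemma trace_star_monomial_mult:
  assumes "canonical_trace U \<tau>"
  shows "\<tau> (star (monomial U m) * monomial U n) = (if n = m then 1 else 0)"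
proof (cases "n = m")
  case True
  then show ?thesis
    using assms unitary_monomial[of m]
    by (auto simp: canonical_trace_def faithful_tracial_state_def unitary_def)
next
  case False
  obtain c where c: "star (monomial U m) * monomial U n = c *\<^sub>C monomial U (n - m)"
    using star_monomial_mult by blast
  have "\<tau> (\<Sum>k\<in>F. a k *\<^sub>C monomial U k) = (if 0 \<in> F then a 0 else 0)" if "finite F" for F a
    using assms that by (simp only: canonical_trace_def)
  from this[of "{n - m}" "\<lambda>_. c"] have "\<tau> (c *\<^sub>C monomial U (n - m)) = (if n = m then c else 0)"
    by simp
  then show ?thesis using False c by simp
qed

end


section \<open>Multipliers of an orthonormal family\<close>

lemma cinner_sum_left: "cinner (\<Sum>n\<in>F. f n) (y :: 'h::complex_hilbert) = (\<Sum>n\<in>F. cinner (f n) y)"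
  using bounded_linear.linear[OF bounded_linear_cinner_left] by (rule linear_sum)

lemma cinner_sum_right: "cinner (x :: 'h::complex_hilbert) (\<Sum>n\<in>F. f n) = (\<Sum>n\<in>F. cinner x (f n))"
  unfolding cinner_commute[of x] by (simp add: cinner_sum_left)

context
  fixes e :: "'i \<Rightarrow> 'h::complex_hilbert"
  assumes orthonormal: "\<And>n m. cinner (e n) (e m) = (if n = m then 1 else 0)"
begin

lemma norm_orthonormal_sum:
  assumes "finite F"
  shows "(norm (\<Sum>n\<in>F. c n *\<^sub>C e n))\<^sup>2 = (\<Sum>n\<in>F. (cmod (c n))\<^sup>2)"
proof -
  have "complex_of_real ((norm (\<Sum>n\<in>F. c n *\<^sub>C e n))\<^sup>2)
      = (\<Sum>n\<in>F. \<Sum>m\<in>F. cnj (c n) * (c m * (if m = n then 1 else 0)))"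
    by (simp only: cinner_self[symmetric] cinner_sum_left cinner_sum_right cinner_scaleC_left
        cinner_scaleC_right orthonormal sum_distrib_left)
  also have "\<dots> = (\<Sum>n\<in>F. c n * cnj (c n))"
    using assms by (simp add: if_distrib mult.commute cong: if_cong)
  also have "\<dots> = of_real (\<Sum>n\<in>F. (cmod (c n))\<^sup>2)"
    by (simp add: complex_norm_square[symmetric])
  finally show ?thesis by (simp only: of_real_eq_iff)
qed

text \<open>With p the projection of x onto the finite span, x \<bullet> p and p \<bullet> p both
  equal the sum, and positivity of the squared distance from x to p gives the bound.\<close>

lemma bessel_inequality:
  assumes F: "finite F"
  shows "(\<Sum>n\<in>F. (cmod (cinner x (e n)))\<^sup>2) \<le> (norm x)\<^sup>2"
proof -
  define p where "p = (\<Sum>n\<in>F. cinner x (e n) *\<^sub>C e n)"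
  have "x \<bullet> p = (\<Sum>n\<in>F. (cmod (cinner x (e n)))\<^sup>2)"
    by (simp add: p_def inner_eq_Re_cinner cinner_sum_right cinner_scaleC_right cmod_power2
        power2_eq_square[symmetric])
  moreover have "p \<bullet> p = (\<Sum>n\<in>F. (cmod (cinner x (e n)))\<^sup>2)"
    unfolding power2_norm_eq_inner[symmetric] p_def by (rule norm_orthonormal_sum[OF F])
  moreover have "0 \<le> (x - p) \<bullet> (x - p)" by simp
  ultimately show ?thesis
    by (simp add: inner_diff_left inner_diff_right inner_commute power2_norm_eq_inner)
qed

text \<open>Finite partial sums obey the bound uniformly by Bessel, and y is their limit along the
  finite subsets.\<close>

lemma norm_multiplier_le:
  assumes sum: "((\<lambda>n. (\<mu> n * cinner x (e n)) *\<^sub>C e n) has_sum y) UNIV"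
    and \<mu>: "\<And>n. cmod (\<mu> n) \<le> K" and K: "K \<ge> 0"
  shows "norm y \<le> K * norm x"
proof -
  have fin: "norm (\<Sum>n\<in>F. (\<mu> n * cinner x (e n)) *\<^sub>C e n) \<le> K * norm x" if F: "finite F" for F
  proof (rule power2_le_imp_le)
    have "(norm (\<Sum>n\<in>F. (\<mu> n * cinner x (e n)) *\<^sub>C e n))\<^sup>2 = (\<Sum>n\<in>F. (cmod (\<mu> n))\<^sup>2 * (cmod (cinner x (e n)))\<^sup>2)"
      by (simp add: norm_orthonormal_sum[OF F] norm_mult power_mult_distrib)
    also have "\<dots> \<le> (\<Sum>n\<in>F. K\<^sup>2 * (cmod (cinner x (e n)))\<^sup>2)"
      by (intro sum_mono mult_right_mono power_mono \<mu>) auto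
    also have "\<dots> = K\<^sup>2 * (\<Sum>n\<in>F. (cmod (cinner x (e n)))\<^sup>2)" by (simp add: sum_distrib_left)
    also have "\<dots> \<le> K\<^sup>2 * (norm x)\<^sup>2" by (intro mult_left_mono bessel_inequality F) auto
    finally show "(norm (\<Sum>n\<in>F. (\<mu> n * cinner x (e n)) *\<^sub>C e n))\<^sup>2 \<le> (K * norm x)\<^sup>2"
      by (simp add: power_mult_distrib)
  qed (use K in simp)
  have "((\<lambda>F. norm (\<Sum>n\<in>F. (\<mu> n * cinner x (e n)) *\<^sub>C e n)) \<longlongrightarrow> norm y) (finite_subsets_at_top UNIV)"
    using sum unfolding has_sum_def by (rule tendsto_norm)
  moreover have "\<forall>\<^sub>F F in finite_subsets_at_top UNIV. norm (\<Sum>n\<in>F. (\<mu> n * cinner x (e n)) *\<^sub>C e n) \<le> K * norm x"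
    using fin by (intro eventually_finite_subsets_at_top_weakI) auto
  ultimately show ?thesis by (rule tendsto_upperbound) simp
qed

end


section \<open>The decay estimate\<close>

text \<open>This lower bound is what makes the decay uniform in n: C / (t powr \<alpha> \<lambda>)
  is at most C / t powr \<alpha> for every eigenvalue \<lambda>.\<close>

lemma bessel_symbol_ge_1: "s \<ge> 0 \<Longrightarrow> bessel_symbol s n \<ge> 1"
  unfolding bessel_symbol_def by (intro ge_one_powr_ge_zero) (auto simp: sum_nonneg)

theorem theorem4p15:
  fixes \<theta> :: "real ^ ('d::{finite,linorder}) ^ ('d::{finite,linorder})"
    and U :: "'d \<Rightarrow> 'a::cstar_algebra"
    and \<tau> :: "'a \<Rightarrow> complex"
    and \<pi> :: "'a \<Rightarrow> ('h::complex_hilbert \<Rightarrow>\<^sub>L 'h)"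
    and \<Omega> :: 'h
    and \<tau>\<^sub>M :: "('h \<Rightarrow>\<^sub>L 'h) \<Rightarrow> complex"
    and \<iota> :: "('h \<Rightarrow>\<^sub>L 'h) \<Rightarrow> 'l::complex_hilbert"
    and s \<alpha> :: real
    and u\<^sub>0 :: 'l
    and u :: "real \<Rightarrow> 'l"
  assumes "CARD('d) \<ge> 2"
    and "transpose \<theta> = - \<theta>"
    and "universal_torus_algebra TYPE('b::cstar_algebra) \<theta> U"
    and "canonical_trace U \<tau>"
    and "gns_representation \<tau> \<pi> \<Omega>"
    and "normal_faithful_tracial_state (nc_torus \<pi>) \<tau>\<^sub>M"
    and "\<And>a. \<tau>\<^sub>M (\<pi> a) = \<tau> a"
    and "nc_L2_space (nc_torus \<pi>) \<tau>\<^sub>M \<iota>"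
    and "s = real CARD('d) / 2"
    and "0 < \<alpha>" and "\<alpha> \<le> 1"
    and "u\<^sub>0 \<noteq> 0"
    and "mild_solution U \<pi> \<tau>\<^sub>M \<iota> s \<alpha> u\<^sub>0 u"
  shows "\<exists>c>0. \<forall>t>0. norm (u t) \<le> c * t powr (- \<alpha>)"
proof -
  interpret nc_torus_L2 \<pi> \<tau>\<^sub>M \<iota>
    using assms(5,6,8) by unfold_locales (simp_all add: gns_representation_def)
  have rel: "torus_relations \<theta> U" using assms(3) by (simp add: universal_torus_algebra_def)
  define e where "e n = \<iota> (\<pi> (monomial U n))" for n
  have orthonormal: "cinner (e n) (e m) = (if n = m then 1 else 0)" for n m
    unfolding e_def
    by (simp only: cinner_iota range_M pi_simps[symmetric] assms(7) trace_star_monomial_mult[OF rel assms(4)])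
  obtain C where C: "C > 0" "\<And>x. x > 0 \<Longrightarrow> cmod (mittag_leffler \<alpha> (of_real (- x))) \<le> C / x"
    using mittag_leffler_decay assms(10,11) by metis
  show ?thesis
  \<comment> \<open>The constant is strictly positive because the initial value is nonzero.\<close>
  proof (intro exI[of _ "C * norm u\<^sub>0"] conjI allI impI)
    show "C * norm u\<^sub>0 > 0" using C assms(12) by simp
    fix t :: real assume t: "t > 0"
    define \<mu> where "\<mu> n = mittag_leffler \<alpha> (of_real (- (t powr \<alpha>) * bessel_symbol s n))"
      for n :: "int ^ ('d::{finite,linorder})"
    have "norm (u t) \<le> C / t powr \<alpha> * norm u\<^sub>0"
    proof (rule norm_multiplier_le[OF orthonormal])
      show "((\<lambda>n. (\<mu> n * cinner u\<^sub>0 (e n)) *\<^sub>C e n) has_sum u t) UNIV"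
        using assms(13) t
        by (simp add: mild_solution_def fourier_coeff_eq_cinner range_M \<mu>_def e_def)
      show "cmod (\<mu> n) \<le> C / t powr \<alpha>" for n
      proof -
        have b: "bessel_symbol s n \<ge> 1" using assms(9) by (intro bessel_symbol_ge_1) simp
        have "cmod (\<mu> n) \<le> C / (t powr \<alpha> * bessel_symbol s n)"
          using C(2)[of "t powr \<alpha> * bessel_symbol s n"] b t by (simp add: \<mu>_def)
        also have "\<dots> \<le> C / t powr \<alpha>"
          using b t C(1) by (intro divide_left_mono) (auto simp: mult_le_cancel_left1)
        finally show ?thesis .
      qed
      show "0 \<le> C / t powr \<alpha>" using C(1) by simp
    qed
    then show "norm (u t) \<le> C * norm u\<^sub>0 * t powr (- \<alpha>)"
      by (simp add: powr_minus divide_inverse mult_ac)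
  qed
qed

end
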